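(* Let $k\ge1$, $m=2k$, $n\ge 1$, and let $q$ be a nonzero complex number with $q^{8\binom{k}{2}}=1$. In the quantum matrix algebra $M_q(mn)$ put, for $1\le i_1<\cdots<i_m\le mn$, $$[i_1,i_2,\dots,i_m]_m=b_{i_1,i_2,\dots,i_m}=\sum_{i=1}^n\xi_{m(i-1)+1,\dots,mi}^{i_1,\dots,i_m}.$$ Then the quantum hyper-Pfaffian built from these elements satisfies $$[1,2,\dots,mn]_m={\det}_q(a_{ij})_{1\le i,j\le mn}.$$
   Context: $M_q(N)$ is the unital associative complex algebra generated by $a_{ij}$, $1\le i,j\le N$, subject to the relations, for all $i<j$ and $k<l$: $a_{ik}a_{il}=qa_{il}a_{ik}$, $a_{ik}a_{jk}=qa_{jk}a_{ik}$, $a_{jk}a_{il}=a_{il}a_{jk}$, $a_{ik}a_{jl}-a_{jl}a_{ik}=(q-q^{-1})a_{il}a_{jk}$. For $i_1<\cdots<i_s$ and $j_1<\cdots<j_s$ the quantum minor (rows on top, columns below) is $\xi^{i_1,\dots,i_s}_{j_1,\dots,j_s}=\sum_{\sigma\in S_s}(-q)^{l(\sigma)}a_{i_1,j_{\sigma(1)}}\cdots a_{i_s,j_{\sigma(s)}}$, with $l(\sigma)$ the number of inversions; ${\det}_q(a_{ij})_{1\le i,j\le N}=\xi^{1,\dots,N}_{1,\dots,N}$. Quantum hyper-Pfaffian: given elements $b_{i_1,\dots,i_m}$ ($1\le i_1<\cdots<i_m\le mn$) of an associative algebra, put $[i_1,\dots,i_m]_m=b_{i_1,\dots,i_m}$ and,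 for $s_1<\cdots<s_{mp}$ in $\{1,\dots,mn\}$ with $p\ge 2$, inductively $$[s_1,\dots,s_{mp}]_m=\sum_{1<j_2<\cdots<j_m\le mp}(-q)^{\sum_{t=2}^m(j_t-t)}[s_1,s_{j_2},\dots,s_{j_m}]_m\,[s_2,\dots,\widehat{s_{j_2}},\dots,\widehat{s_{j_m}},\dots,s_{mp}]_m$$ (hats mean omitted entries). The quantum hyper-Pfaffian is $[1,2,\dots,mn]_m$. *)

theory Defs
  imports
    "HOL-Library.Poly_Mapping"
    "HOL-Combinatorics.Permutations"
    "HOL-Algebra.QuotRing"
    "HOL-Algebra.Module"
    Complex_Main
begin

section \<open>The free complex algebra on a finite square array of generators\<close>

text \<open>
  Words under concatenation, written additively because \<^typ>\<open>'a \<Rightarrow>\<^sub>0 'b\<close> carries the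
  convolution product when its index type is an additive monoid.
\<close>

datatype 'a word = Word (letters: "'a list")

instantiation word :: (type) monoid_add
begin

definition zero_word :: "'a word" where
  "0 = Word []"

definition plus_word :: "'a word \<Rightarrow> 'a word \<Rightarrow> 'a word" where
  "u + v = Word (letters u @ letters v)"

instance
  by standard (simp_all add: zero_word_def plus_word_def)

end

type_synonym ncpoly = "(nat \<times> nat) word \<Rightarrow>\<^sub>0 complex"

text \<open>
  The scalar multiplication is kept in the \<^term>\<open>smult\<close> field of the record type for modules,
  so a complex algebra is a record of type \<^typ>\<open>(complex, 'a) module\<close>.
\<close>

definition free_algebra :: "nat \<Rightarrow> (complex, ncpoly) module" where
  "free_algebra N =
     \<lparr>carrier = {p. \<forall>w \<in> Poly_Mapping.keys p. set (letters w) \<subseteq> {1..N} \<times> {1..N}},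
      mult = (*), one = 1, zero = 0, add = (+),
      smult = (\<lambda>c p. Poly_Mapping.map ((*) c) p)\<rparr>"

definition var :: "nat \<Rightarrow> nat \<Rightarrow> ncpoly" where
  "var i j = Poly_Mapping.single (Word [(i, j)]) 1"

definition scal :: "complex \<Rightarrow> ncpoly" where
  "scal c = Poly_Mapping.single 0 c"


section \<open>The quantum matrix algebra\<close>

text \<open>
  Each relation \<open>l = r\<close> is recorded as the element \<open>l - r\<close>. The relation within one row (one
  column) is imposed for every row (every column), the last one included.
\<close>

definition qmat_relators :: "complex \<Rightarrow> nat \<Rightarrow> ncpoly set" where
  "qmat_relators q N =
     {var i k * var i l - scal q * var i l * var i k | i k l.
        i \<in> {1..N} \<and> k \<in> {1..N} \<and> l \<in> {1..N} \<and> k < l}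
   \<union> {var i k * var j k - scal q * var j k * var i k | i j k.
        i \<in> {1..N} \<and> j \<in> {1..N} \<and> k \<in> {1..N} \<and> i < j}
   \<union> {var j k * var i l - var i l * var j k | i j k l.
        i \<in> {1..N} \<and> j \<in> {1..N} \<and> k \<in> {1..N} \<and> l \<in> {1..N} \<and> i < j \<and> k < l}
   \<union> {var i k * var j l - var j l * var i k - scal (q - inverse q) * var i l * var j k | i j k l.
        i \<in> {1..N} \<and> j \<in> {1..N} \<and> k \<in> {1..N} \<and> l \<in> {1..N} \<and> i < j \<and> k < l}"

definition qmat_ideal :: "complex \<Rightarrow> nat \<Rightarrow> ncpoly set" where
  "qmat_ideal q N = Idl\<^bsub>free_algebra N\<^esub> (qmat_relators q N)"

text \<open>
  The ring structure is that of \<^term>\<open>free_algebra N Quot qmat_ideal q N\<close>; the union in the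
  \<^term>\<open>smult\<close> field follows the pattern of \<^term>\<open>rcoset_mult\<close>.
\<close>

definition quantum_matrix_algebra :: "complex \<Rightarrow> nat \<Rightarrow> (complex, ncpoly set) module" where
  "quantum_matrix_algebra q N =
     ring.extend (free_algebra N Quot qmat_ideal q N)
       (module.fields
         (\<lambda>c X. \<Union>x\<in>X. qmat_ideal q N +>\<^bsub>free_algebra N\<^esub> (c \<odot>\<^bsub>free_algebra N\<^esub> x)))"

definition qmat_gen :: "complex \<Rightarrow> nat \<Rightarrow> nat \<Rightarrow> nat \<Rightarrow> ncpoly set" where
  "qmat_gen q N i j = qmat_ideal q N +>\<^bsub>free_algebra N\<^esub> var i j"


section \<open>Quantum minors and quantum hyper-Pfaffians\<close>

text \<open>
  These are defined over an arbitrary complex algebra \<open>R\<close>. An increasing tuple of indices is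
  represented by the list of its entries.
\<close>

definition inversions :: "nat \<Rightarrow> (nat \<Rightarrow> nat) \<Rightarrow> nat" where
  "inversions s \<sigma> = card {(t, u). t < u \<and> u < s \<and> \<sigma> t > \<sigma> u}"

definition ordered_prod :: "('a, 'b) monoid_scheme \<Rightarrow> 'a list \<Rightarrow> 'a" where
  "ordered_prod R xs = foldr (\<lambda>x y. x \<otimes>\<^bsub>R\<^esub> y) xs \<one>\<^bsub>R\<^esub>"

text \<open>Rows \<open>is\<close>, columns \<open>js\<close>; positions in the lists, hence permutations, are counted from 0.\<close>

definition quantum_minor ::
  "(complex, 'a, 'b) module_scheme \<Rightarrow> complex \<Rightarrow> (nat \<Rightarrow> nat \<Rightarrow> 'a) \<Rightarrow> nat list \<Rightarrow> nat list \<Rightarrow> 'a"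
where
  "quantum_minor R q a is js =
     (\<Oplus>\<^bsub>R\<^esub>\<sigma> \<in> {\<sigma>. \<sigma> permutes {..<length is}}.
        (- q) ^ inversions (length is) \<sigma> \<odot>\<^bsub>R\<^esub>
          ordered_prod R (map (\<lambda>t. a (is ! t) (js ! \<sigma> t)) [0..<length is]))"

definition quantum_det ::
  "(complex, 'a, 'b) module_scheme \<Rightarrow> complex \<Rightarrow> (nat \<Rightarrow> nat \<Rightarrow> 'a) \<Rightarrow> nat \<Rightarrow> 'a"
where
  "quantum_det R q a N = quantum_minor R q a [1..<N + 1] [1..<N + 1]"

text \<open>
  \<open>hyper_pf_bracket R q m b p s\<close> is the bracket $[s_1,\dots,s_{mp}]_m$. In the recursion the set
  \<open>J\<close> is $\{j_2 < \dots < j_m\}$, so the exponent $\sum_{t=2}^m (j_t - t)$ is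
  \<open>\<Sum>J - \<Sum>{2..m}\<close>, where the subtraction does not truncate since $j_t \ge t$. The positions
  \<open>j\<close> are counted from 1, those of \<^term>\<open>nths\<close> from 0. The case \<open>p = 0\<close> does not occur in
  the mathematics.
\<close>

fun hyper_pf_bracket ::
  "(complex, 'a, 'b) module_scheme \<Rightarrow> complex \<Rightarrow> nat \<Rightarrow> (nat list \<Rightarrow> 'a) \<Rightarrow> nat \<Rightarrow> nat list \<Rightarrow> 'a"
where
  "hyper_pf_bracket R q m b 0 s = \<one>\<^bsub>R\<^esub>"
| "hyper_pf_bracket R q m b (Suc 0) s = b s"
| "hyper_pf_bracket R q m b (Suc (Suc p)) s =
     (\<Oplus>\<^bsub>R\<^esub>J \<in> {J. J \<subseteq> {2..m * Suc (Suc p)} \<and> card J = m - 1}.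
        (- q) ^ (\<Sum>J - \<Sum>{2..m}) \<odot>\<^bsub>R\<^esub>
          (b (nths s {i. Suc i \<in> insert 1 J}) \<otimes>\<^bsub>R\<^esub>
           hyper_pf_bracket R q m b (Suc p) (nths s {i. Suc i \<notin> insert 1 J})))"

definition quantum_hyper_pfaffian ::
  "(complex, 'a, 'b) module_scheme \<Rightarrow> complex \<Rightarrow> nat \<Rightarrow> nat \<Rightarrow> (nat list \<Rightarrow> 'a) \<Rightarrow> 'a"
where
  "quantum_hyper_pfaffian R q m n b = hyper_pf_bracket R q m b n [1..<m * n + 1]"


section \<open>The quantum matrix algebra is a ring\<close>

lemma keys_mult_letters:
  fixes p r :: ncpoly
  assumes "\<forall>w \<in> Poly_Mapping.keys p. set (letters w) \<subseteq> A"
    and "\<forall>w \<in> Poly_Mapping.keys r. set (letters w) \<subseteq> A"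
  shows "\<forall>w \<in> Poly_Mapping.keys (p * r). set (letters w) \<subseteq> A"
proof
  fix w assume "w \<in> Poly_Mapping.keys (p * r)"
  then obtain u v where "u \<in> Poly_Mapping.keys p" "v \<in> Poly_Mapping.keys r" "w = u + v"
    using keys_mult[of p r] by blast
  with assms show "set (letters w) \<subseteq> A"
    by (simp add: plus_word_def)
qed

lemma ring_free_algebra: "ring (free_algebra N)"
proof -
  let ?F = "free_algebra N"
  have sel: "mult ?F = (*)" "one ?F = 1" "zero ?F = 0" "add ?F = (+)"
    by (simp_all add: free_algebra_def)
  have in_carrier: "p \<in> carrier ?F \<longleftrightarrow>
      (\<forall>w \<in> Poly_Mapping.keys p. set (letters w) \<subseteq> {1..N} \<times> {1..N})" for p
    unfolding free_algebra_def by simp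
  have zero: "0 \<in> carrier ?F"
    unfolding in_carrier by simp
  have one: "1 \<in> carrier ?F"
    unfolding in_carrier by (simp add: zero_word_def)
  have add: "x + y \<in> carrier ?F" if "x \<in> carrier ?F" "y \<in> carrier ?F" for x y
    using that Poly_Mapping.keys_add[of x y] unfolding in_carrier by blast
  have uminus: "- x \<in> carrier ?F" if "x \<in> carrier ?F" for x
    using that unfolding in_carrier by simp
  have mult: "x * y \<in> carrier ?F" if "x \<in> carrier ?F" "y \<in> carrier ?F" for x y
    using that unfolding in_carrier by (rule keys_mult_letters)
  have "abelian_group ?F"
  proof (rule abelian_groupI)
    fix x assume "x \<in> carrier ?F"
    then show "\<exists>y \<in> carrier ?F. y \<oplus>\<^bsub>?F\<^esub> x = \<zero>\<^bsub>?F\<^esub>"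
      unfolding sel by (intro bexI[OF _ uminus]) (rule left_minus)
  qed (simp_all only: sel add zero add.assoc add_0_left, rule add.commute)
  moreover have "monoid ?F"
    by (rule monoidI) (simp_all only: sel mult one mult.assoc mult_1_left mult_1_right)
  ultimately show ?thesis
    by (rule ringI) (simp_all only: sel distrib_left distrib_right)
qed

lemma ideal_qmat_ideal: "ideal (qmat_ideal q N) (free_algebra N)"
proof -
  interpret F: ring "free_algebra N" by (rule ring_free_algebra)
  have var: "var i j \<in> carrier (free_algebra N)" if "i \<in> {1..N}" "j \<in> {1..N}" for i j
    using that by (simp add: var_def free_algebra_def)
  have scal: "scal c \<in> carrier (free_algebra N)" for c
    by (simp add: scal_def free_algebra_def zero_word_def)
  have mult: "x * y \<in> carrier (free_algebra N)"
    if "x \<in> carrier (free_algebra N)" "y \<in> carrier (free_algebra N)" for x y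
    using F.m_closed[OF that] by (simp add: free_algebra_def)
  have minus: "x - y \<in> carrier (free_algebra N)"
    if "x \<in> carrier (free_algebra N)" "y \<in> carrier (free_algebra N)" for x y
  proof -
    have "x + (- y) \<in> carrier (free_algebra N)"
      using that Poly_Mapping.keys_add[of x "- y"] by (auto simp: free_algebra_def)
    then show ?thesis by simp
  qed
  have "qmat_relators q N \<subseteq> carrier (free_algebra N)"
    unfolding qmat_relators_def
    by (intro subsetI, elim UnE CollectE exE conjE) (simp_all only: var scal mult minus)
  then show ?thesis
    unfolding qmat_ideal_def by (rule F.genideal_ideal)
qed

lemma ring_quantum_matrix_algebra: "ring (quantum_matrix_algebra q N)"
proof -
  let ?Q = "free_algebra N Quot qmat_ideal q N"
  let ?M = "quantum_matrix_algebra q N"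
  interpret Q: ring ?Q
    by (rule ideal.quotient_is_ring[OF ideal_qmat_ideal])
  have sel: "carrier ?M = carrier ?Q" "mult ?M = mult ?Q" "one ?M = one ?Q"
    "zero ?M = zero ?Q" "add ?M = add ?Q"
    by (simp_all add: quantum_matrix_algebra_def ring.defs module.defs)
  show ?thesis
  proof (rule ringI)
    show "abelian_group ?M"
    proof (rule abelian_groupI)
      fix x assume "x \<in> carrier ?M"
      then show "\<exists>y \<in> carrier ?M. y \<oplus>\<^bsub>?M\<^esub> x = \<zero>\<^bsub>?M\<^esub>"
        by (intro bexI[of _ "\<ominus>\<^bsub>?Q\<^esub> x"]) (simp_all add: sel Q.l_neg)
    next
      fix x y z assume "x \<in> carrier ?M" "y \<in> carrier ?M" "z \<in> carrier ?M"
      then show "x \<oplus>\<^bsub>?M\<^esub> y \<oplus>\<^bsub>?M\<^esub> z = x \<oplus>\<^bsub>?M\<^esub> (y \<oplus>\<^bsub>?M\<^esub> z)"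
        unfolding sel by (rule Q.a_assoc)
    next
      fix x y assume "x \<in> carrier ?M" "y \<in> carrier ?M"
      then show "x \<oplus>\<^bsub>?M\<^esub> y = y \<oplus>\<^bsub>?M\<^esub> x"
        unfolding sel by (rule Q.a_comm)
    qed (simp_all add: sel)
    show "monoid ?M"
      by (rule monoidI) (simp_all add: sel Q.m_assoc)
  qed (simp_all add: sel Q.l_distr Q.r_distr)
qed

lemma smult_quantum_matrix_algebra:
  assumes "x \<in> carrier (free_algebra N)"
  shows "c \<odot>\<^bsub>quantum_matrix_algebra q N\<^esub> (qmat_ideal q N +>\<^bsub>free_algebra N\<^esub> x) =
         qmat_ideal q N +>\<^bsub>free_algebra N\<^esub> (c \<odot>\<^bsub>free_algebra N\<^esub> x)"
proof -
  let ?F = "free_algebra N" and ?I = "qmat_ideal q N"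
  interpret I: ideal ?I ?F by (rule ideal_qmat_ideal)
  have scal: "scal c \<in> carrier ?F"
    by (simp add: scal_def free_algebra_def zero_word_def)
  have smult: "c \<odot>\<^bsub>?F\<^esub> y = scal c \<otimes>\<^bsub>?F\<^esub> y" for y
    by (simp add: free_algebra_def scal_def mult_map_scale_conv_mult)
  have "?I +>\<^bsub>?F\<^esub> (c \<odot>\<^bsub>?F\<^esub> y) = ?I +>\<^bsub>?F\<^esub> (c \<odot>\<^bsub>?F\<^esub> x)" if y: "y \<in> ?I +>\<^bsub>?F\<^esub> x" for y
  proof -
    obtain h where h: "h \<in> ?I" "y = h \<oplus>\<^bsub>?F\<^esub> x"
      using y by (auto simp: a_r_coset_def')
    have "c \<odot>\<^bsub>?F\<^esub> y = scal c \<otimes>\<^bsub>?F\<^esub> h \<oplus>\<^bsub>?F\<^esub> c \<odot>\<^bsub>?F\<^esub> x"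
      using h assms scal I.a_subset by (simp add: smult I.r_distr subset_iff)
    moreover have "scal c \<otimes>\<^bsub>?F\<^esub> h \<in> ?I"
      using I.I_l_closed[OF h(1) scal] .
    ultimately have "c \<odot>\<^bsub>?F\<^esub> y \<in> ?I +>\<^bsub>?F\<^esub> (c \<odot>\<^bsub>?F\<^esub> x)"
      by (auto simp: a_r_coset_def')
    then show ?thesis
      using I.a_repr_independence'[of "c \<odot>\<^bsub>?F\<^esub> y" "c \<odot>\<^bsub>?F\<^esub> x"] I.m_closed[OF scal assms]
      by (simp only: smult)
  qed
  moreover have "x \<in> ?I +>\<^bsub>?F\<^esub> x"
    using assms by (rule I.a_rcos_self)
  ultimately have "(\<Union>y \<in> ?I +>\<^bsub>?F\<^esub> x. ?I +>\<^bsub>?F\<^esub> (c \<odot>\<^bsub>?F\<^esub> y)) = ?I +>\<^bsub>?F\<^esub> (c \<odot>\<^bsub>?F\<^esub> x)"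
    by blast
  then show ?thesis
    by (simp only: quantum_matrix_algebra_def ring.defs module.defs module.select_convs)
qed

end

(*
  A bracket over p blocks is the sum, over the p-element sets D of column blocks, of the quantum
  minors with columns in the union of D; this is proved by induction on p. In the recursion, the
  factor b contributes a minor whose first row is s_1 (the recursion always puts s_1 there), and this
  minor is expanded along that row. The sum over the remaining rows is then a Laplace expansion,
  which evaluates to a minor with reordered columns, or to 0 if the column block of b occurs again
  in the second factor (here m >= 2 is used). Reordering the columns past r earlier blocks costs
  (-q)^((m - 1) m r), whereas the expansion of the larger minor along row s_1 asks for (-q)^(m r).
  The quotient is a power of (-q)^(m (m - 2)) = q^(8 binom(k, 2)) = 1. No division by quantum
  integers takes place, so that roots of unity need no separate treatment.
*)

theory Submission
  imports Defs "HOL-Combinatorics.Multiset_Permutations"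
begin

section \<open>Products in the quantum exterior algebra\<close>

text \<open>Minors are needed in two forms. With the factors ordered by rows, as in the definition,
  splitting off the first row is immediate. With the factors ordered by columns, the Laplace
  expansion over complementary sets of rows is immediate, and a misplaced or repeated column is a
  question about sorting a word modulo the relations. The recursion needs both: row s_1 is fixed in
  the first factor, so it has to be split off before the remaining rows can be distributed freely.
  The bridge is \<open>cdet_eqv_rdet\<close>. All of this is computed on representatives in the free
  algebra, which is a type of class \<open>ring_1\<close>, modulo an abstract congruence; the
  quotient record enters only when the result is projected.\<close>

definition below :: "nat set \<Rightarrow> nat \<Rightarrow> nat" where
  "below S i = card {s \<in> S. s < i}"

text \<open>For disjoint I and J this is the exponent in x_I x_J = Q^e x_(I Un J), where x_j x_i = Q
  x_i x_j for i < j: each pair that stands in the wrong order costs one Q.\<close>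

definition cross_inv :: "nat set \<Rightarrow> nat set \<Rightarrow> nat" where
  "cross_inv I J = (\<Sum>i\<in>I. below J i)"

lemma below_insert:
  assumes "finite S" "x \<notin> S"
  shows "below (insert x S) i = (if x < i then 1 else 0) + below S i"
proof -
  have "{s \<in> insert x S. s < i} = (if x < i then insert x {s \<in> S. s < i} else {s \<in> S. s < i})"
    by auto
  then show ?thesis
    using assms by (simp add: below_def)
qed

lemma below_remove:
  assumes "finite S" "x \<in> S"
  shows "below S i = (if x < i then 1 else 0) + below (S - {x}) i"
  using below_insert[of "S - {x}" x i] assms by (simp add: insert_absorb)

lemma below_Un_disjoint:
  assumes "finite S" "finite T" "S \<inter> T = {}"
  shows "below (S \<union> T) i = below S i + below T i"
proof -
  have "{s \<in> S \<union> T. s < i} = {s \<in> S. s < i} \<union> {s \<in> T. s < i}" by auto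
  then show ?thesis
    using assms by (simp add: below_def card_Un_disjoint disjoint_iff)
qed

lemma below_eq_0: "(\<And>s. s \<in> S \<Longrightarrow> i \<le> s) \<Longrightarrow> below S i = 0"
  by (force simp: below_def)

lemma below_eq_card: "(\<And>s. s \<in> S \<Longrightarrow> s < i) \<Longrightarrow> below S i = card S"
  by (auto simp: below_def intro!: arg_cong[where f = card])

lemma sorted_list_of_set_insert_less:
  assumes "finite S" "\<And>s. s \<in> S \<Longrightarrow> x < s"
  shows "sorted_list_of_set (insert x S) = x # sorted_list_of_set S"
proof -
  have "x \<notin> S" using assms(2) by blast
  then show ?thesis
    using assms by (simp add: sorted_list_of_set_insert insort_is_Cons less_imp_le)
qed

lemma Min_less: "finite S \<Longrightarrow> s \<in> S - {Min S} \<Longrightarrow> Min S < (s :: nat)"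
  by (metis Diff_iff Min_le insertCI nless_le)

text \<open>
  With \<open>x\<close> the generators of the quantum exterior algebra (\<open>x\<^sub>j x\<^sub>i = Q x\<^sub>i x\<^sub>j\<close> for \<open>i < j\<close>) and
  \<open>\<omega>\<^sub>c = (\<Sum>i. a i c x\<^sub>i)\<close>, this is the coefficient of \<open>x\<^sub>S\<close> in the product of the \<open>\<omega>\<^sub>c\<close> along a
  list of columns, expanded at its first factor.
\<close>

fun wcoeff :: "'a::ring_1 \<Rightarrow> (nat \<Rightarrow> nat \<Rightarrow> 'a) \<Rightarrow> nat set \<Rightarrow> nat list \<Rightarrow> 'a" where
  "wcoeff Q a S [] = (if S = {} then 1 else 0)"
| "wcoeff Q a S (c # w) = (\<Sum>i\<in>S. Q ^ below S i * (a i c * wcoeff Q a (S - {i}) w))"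

text \<open>Homogeneity: a product of \<open>length w\<close> linear forms has only monomials of
  that degree.\<close>

lemma wcoeff_eq_0:
  "finite S \<Longrightarrow> card S \<noteq> length w \<Longrightarrow> wcoeff Q a S w = 0"
proof (induction w arbitrary: S)
  case (Cons c w)
  have "wcoeff Q a (S - {i}) w = 0" if "i \<in> S" for i
    using that Cons.prems by (intro Cons.IH) (auto dest: card_Suc_Diff1)
  then show ?case by simp
qed auto

lemma power_central:
  fixes Q :: "'a::ring_1"
  assumes "\<And>x. Q * x = x * Q"
  shows "x * (Q ^ n * y) = Q ^ n * (x * y)"
proof -
  have "x * Q ^ n = Q ^ n * x"
    using power_commuting_commutes[of Q x n] assms by simp
  then show ?thesis
    by (simp flip: mult.assoc)
qed

text \<open>A formal Laplace expansion: the coefficient of x_S in a product of two products, grouped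
  by the set I of indices contributed by the first one.\<close>

lemma wcoeff_append:
  fixes Q :: "'a::ring_1"
  assumes Q: "\<And>x. Q * x = x * Q"
  shows "finite S \<Longrightarrow> wcoeff Q a S (u @ v) =
    (\<Sum>I\<in>Pow S. Q ^ cross_inv I (S - I) * (wcoeff Q a I u * wcoeff Q a (S - I) v))"
proof (induction u arbitrary: S)
  case Nil
  have "(\<Sum>I\<in>Pow S. Q ^ cross_inv I (S - I) * (wcoeff Q a I [] * wcoeff Q a (S - I) v)) =
      (\<Sum>I\<in>Pow S. if I = {} then wcoeff Q a S v else 0)"
    by (rule sum.cong) (auto simp: cross_inv_def)
  then show ?case using Nil by simp
next
  case (Cons c u)
  let ?w = "wcoeff Q a"
  have fin: "finite (S - I)" for I using Cons.prems by blast
  have "?w S ((c # u) @ v) =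
      (\<Sum>i\<in>S. \<Sum>I\<in>Pow (S - {i}). Q ^ (below S i + cross_inv I (S - {i} - I)) *
        (a i c * (?w I u * ?w (S - {i} - I) v)))"
    using Cons.prems
    by (simp add: Cons.IH fin sum_distrib_left power_add mult.assoc power_central[OF Q, of "a _ _"])
  also have "\<dots> = (\<Sum>(i, I)\<in>(SIGMA i:S. Pow (S - {i})). Q ^ (below S i + cross_inv I (S - {i} - I)) *
        (a i c * (?w I u * ?w (S - {i} - I) v)))"
    using Cons.prems by (subst sum.Sigma) auto
  also have "\<dots> = (\<Sum>(I, i)\<in>(SIGMA I:Pow S. I). Q ^ (cross_inv I (S - I) + below I i) *
        (a i c * (?w (I - {i}) u * ?w (S - I) v)))"
  proof (rule sum.reindex_bij_witness[where i = "\<lambda>(I, i). (i, I - {i})" and j = "\<lambda>(i, I). (insert i I, i)"])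
    fix p assume "p \<in> (SIGMA i:S. Pow (S - {i}))"
    then obtain i I where p: "p = (i, I)" "i \<in> S" "I \<subseteq> S - {i}" by auto
    have f: "finite I" "i \<notin> I" using p Cons.prems finite_subset by blast+
    have S: "S = insert i I \<union> (S - insert i I)" using p by blast
    \<comment> \<open>Of the indices that i has to pass, those in I are charged inside the first
      factor, and the remaining ones make up the contribution of i to
      \<open>cross_inv\<close>.\<close>
    have "below S i = below (insert i I) i + below (S - insert i I) i"
      using p Cons.prems f by (subst S, subst below_Un_disjoint) auto
    then have "below S i + cross_inv I (S - {i} - I) =
        cross_inv (insert i I) (S - insert i I) + below (insert i I) i"
      using f by (simp add: cross_inv_def Diff_insert2[symmetric] Diff_insert[symmetric]
        below_insert)
    moreover have "S - {i} - I = S - insert i I" by blast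
    ultimately show "(case case p of (i, I) \<Rightarrow> (insert i I, i) of (I, i) \<Rightarrow>
        Q ^ (cross_inv I (S - I) + below I i) * (a i c * (?w (I - {i}) u * ?w (S - I) v))) =
        (case p of (i, I) \<Rightarrow> Q ^ (below S i + cross_inv I (S - {i} - I)) *
        (a i c * (?w I u * ?w (S - {i} - I) v)))"
      using p f by simp
  qed auto
  also have "\<dots> = (\<Sum>I\<in>Pow S. \<Sum>i\<in>I. Q ^ (cross_inv I (S - I) + below I i) *
        (a i c * (?w (I - {i}) u * ?w (S - I) v)))"
    using Cons.prems by (subst sum.Sigma) (auto intro: finite_subset)
  also have "\<dots> = (\<Sum>I\<in>Pow S. Q ^ cross_inv I (S - I) * (?w I (c # u) * ?w (S - I) v))"
    by (simp add: sum_distrib_left sum_distrib_right power_add mult.assoc)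
  finally show ?case .
qed

text \<open>The choices (i, j) and (j, i) leave the same tail, and the descending one costs exactly
  one more Q. Joined, they give the coefficient of x_i x_j in omega_c omega_d, the form in which the
  quadratic relations can be applied.\<close>

lemma wcoeff_Cons_Cons:
  fixes Q :: "'a::ring_1"
  assumes Q: "\<And>x. Q * x = x * Q" and S: "finite S"
  shows "wcoeff Q a S (c # d # w) =
    (\<Sum>(i, j)\<in>{(i, j). i \<in> S \<and> j \<in> S \<and> i < j}. Q ^ (below S i + below (S - {i}) j) *
      ((a i c * a j d + Q * (a j c * a i d)) * wcoeff Q a (S - {i, j}) w))"
proof -
  let ?f = "\<lambda>(i, j). Q ^ (below S i + below (S - {i}) j) *
      (a i c * a j d * wcoeff Q a (S - {i, j}) w)"
  let ?P = "{(i, j). i \<in> S \<and> j \<in> S \<and> i < j}" and ?R = "{(i, j). i \<in> S \<and> j \<in> S \<and> j < i}"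
  have fP: "finite ?P" "finite ?R"
    by (rule finite_subset[of _ "S \<times> S"], use S in auto)+
  have "wcoeff Q a S (c # d # w) = (\<Sum>i\<in>S. \<Sum>j\<in>S - {i}. ?f (i, j))"
    by (simp add: sum_distrib_left power_add mult.assoc power_central[OF Q, of "a _ _"] Diff_insert2[symmetric])
  also have "\<dots> = sum ?f (SIGMA i:S. S - {i})"
    using S by (subst sum.Sigma) auto
  also have "(SIGMA i:S. S - {i}) = ?P \<union> ?R" by auto
  also have "sum ?f (?P \<union> ?R) = sum ?f ?P + sum ?f ?R"
    by (rule sum.union_disjoint) (use fP in auto)
  also have "sum ?f ?R = (\<Sum>(i, j)\<in>?P. Q ^ (below S i + below (S - {i}) j) *
      (Q * (a j c * a i d) * wcoeff Q a (S - {i, j}) w))"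
  proof (rule sum.reindex_bij_witness[where i = "\<lambda>(i, j). (j, i)" and j = "\<lambda>(i, j). (j, i)"])
    fix p assume "p \<in> ?R"
    then obtain i j where p: "p = (j, i)" "i \<in> S" "j \<in> S" "i < j" by auto
    have "below S j + below (S - {j}) i = Suc (below S i + below (S - {i}) j)"
      using below_remove[of S i j] below_remove[of S j i] S p by simp
    moreover have "S - {j, i} = S - {i, j}" by blast
    ultimately show "(case case p of (i, j) \<Rightarrow> (j, i) of (i, j) \<Rightarrow> Q ^ (below S i + below (S - {i}) j) *
      (Q * (a j c * a i d) * wcoeff Q a (S - {i, j}) w)) = ?f p"
      using p by (simp add: mult.assoc power_central[OF Q, of Q])
  qed auto
  finally show ?thesis
    by (simp add: sum.distrib[symmetric] split_def distrib_left distrib_right)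
qed

section \<open>Calculus of quantum minors modulo the relations\<close>

text \<open>Two candidates for the same quantum minor with rows S and columns K: here the factors
  are ordered by column, in \<open>row_minor\<close> by row. They agree only modulo the
  relations.\<close>

definition column_minor :: "'a::ring_1 \<Rightarrow> (nat \<Rightarrow> nat \<Rightarrow> 'a) \<Rightarrow> nat set \<Rightarrow> nat set \<Rightarrow> 'a" where
  "column_minor Q a S K = wcoeff Q a S (sorted_list_of_set K)"

definition row_minor :: "'a::ring_1 \<Rightarrow> (nat \<Rightarrow> nat \<Rightarrow> 'a) \<Rightarrow> nat set \<Rightarrow> nat set \<Rightarrow> 'a" where
  "row_minor Q a S K = wcoeff Q (\<lambda>i j. a j i) K (sorted_list_of_set S)"

text \<open>
  The relation is a partial equivalence: it holds between \<open>x\<close> and itself exactly on the subalgebra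
  in which the congruence modulo the relations is meant to be considered.
\<close>

locale quantum_matrix_congruence =
  fixes eqv :: "'a::ring_1 \<Rightarrow> 'a \<Rightarrow> bool" (infix \<open>\<approx>\<close> 50)
    and Q :: 'a and a :: "nat \<Rightarrow> nat \<Rightarrow> 'a" and X :: "nat set"
  assumes finite_X: "finite X"
    and eqv_sym: "x \<approx> y \<Longrightarrow> y \<approx> x"
    and eqv_trans [trans]: "x \<approx> y \<Longrightarrow> y \<approx> z \<Longrightarrow> x \<approx> z"
    and eqv_add: "x \<approx> x' \<Longrightarrow> y \<approx> y' \<Longrightarrow> x + y \<approx> x' + y'"
    and eqv_mult: "x \<approx> x' \<Longrightarrow> y \<approx> y' \<Longrightarrow> x * y \<approx> x' * y'"
    and eqv_0: "0 \<approx> 0" and eqv_1: "1 \<approx> 1" and eqv_Q: "Q \<approx> Q"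
    and eqv_a: "i \<in> X \<Longrightarrow> j \<in> X \<Longrightarrow> a i j \<approx> a i j"
    and Q_central: "Q * x = x * Q"
    \<comment> \<open>Comparing coefficients of x_i x_j for i < j, \<open>rel_col\<close> says that
      omega_k omega_k = 0, and \<open>rel_cross\<close> that omega_l omega_k = Q omega_k omega_l for
      k < l.\<close>
    and rel_col: "i \<in> X \<Longrightarrow> j \<in> X \<Longrightarrow> k \<in> X \<Longrightarrow> i < j \<Longrightarrow>
      a i k * a j k + Q * (a j k * a i k) \<approx> 0"
    and rel_comm: "i \<in> X \<Longrightarrow> j \<in> X \<Longrightarrow> k \<in> X \<Longrightarrow> l \<in> X \<Longrightarrow> i < j \<Longrightarrow> k < l \<Longrightarrow>
      a j k * a i l \<approx> a i l * a j k"
    and rel_cross: "i \<in> X \<Longrightarrow> j \<in> X \<Longrightarrow> k \<in> X \<Longrightarrow> l \<in> X \<Longrightarrow> i < j \<Longrightarrow> k < l \<Longrightarrow>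
      a i l * a j k + Q * (a j l * a i k) \<approx> Q * (a i k * a j l + Q * (a j k * a i l))"
begin

lemma eqv_eq_trans [trans]: "x \<approx> y \<Longrightarrow> y = z \<Longrightarrow> x \<approx> z"
  and eq_eqv_trans [trans]: "x = y \<Longrightarrow> y \<approx> z \<Longrightarrow> x \<approx> z"
  by simp_all

lemma eqv_sum: "(\<And>i. i \<in> A \<Longrightarrow> f i \<approx> g i) \<Longrightarrow> sum f A \<approx> sum g A"
  by (induction A rule: infinite_finite_induct) (auto intro: eqv_0 eqv_add)

lemma eqv_Q_power: "Q ^ n \<approx> Q ^ n"
  by (induction n) (auto intro: eqv_1 eqv_Q eqv_mult)

lemma eqv_sum_0: "(\<And>i. i \<in> A \<Longrightarrow> f i \<approx> 0) \<Longrightarrow> sum f A \<approx> 0"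
  using eqv_sum[of A f "\<lambda>_. 0"] by simp

lemma eqv_mult_0: "x \<approx> x \<Longrightarrow> y \<approx> 0 \<Longrightarrow> x * y \<approx> 0"
  using eqv_mult[of x x y 0] by simp

lemmas Q_power_central = power_central[of Q "a _ _", OF Q_central]

lemma Q_power_left_commute: "Q ^ m * (Q ^ n * x) = Q ^ n * (Q ^ m * x)"
  by (simp flip: mult.assoc power_add add: add.commute)

abbreviation cexp :: "nat set \<Rightarrow> nat list \<Rightarrow> 'a" where
  "cexp \<equiv> wcoeff Q a"

abbreviation cdet :: "nat set \<Rightarrow> nat set \<Rightarrow> 'a" where
  "cdet \<equiv> column_minor Q a"

abbreviation rdet :: "nat set \<Rightarrow> nat set \<Rightarrow> 'a" where
  "rdet \<equiv> row_minor Q a"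

section \<open>Sorting words of columns\<close>

lemma cexp_refl: "S \<subseteq> X \<Longrightarrow> set w \<subseteq> X \<Longrightarrow> cexp S w \<approx> cexp S w"
proof (induction w arbitrary: S)
  case (Cons c w)
  have "cexp (S - {i}) w \<approx> cexp (S - {i}) w" for i
    using Cons.prems by (intro Cons.IH) auto
  moreover have "a i c \<approx> a i c" if "i \<in> S" for i
    using Cons.prems that by (auto intro: eqv_a)
  ultimately show ?case
    by (auto intro!: eqv_sum eqv_mult eqv_Q_power)
qed (auto intro: eqv_0 eqv_1)

lemma cexp_Cons_cong:
  assumes "S \<subseteq> X" "c \<in> X" "\<And>T. T \<subseteq> X \<Longrightarrow> cexp T w \<approx> Q ^ n * cexp T w'"
  shows "cexp S (c # w) \<approx> Q ^ n * cexp S (c # w')"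
proof -
  have "cexp S (c # w) \<approx> (\<Sum>i\<in>S. Q ^ below S i * (a i c * (Q ^ n * cexp (S - {i}) w')))"
    unfolding wcoeff.simps using assms
    by (intro eqv_sum eqv_mult eqv_Q_power eqv_a assms(3)) auto
  then show ?thesis
    by (simp add: sum_distrib_left Q_power_central Q_power_left_commute)
qed

lemma cexp_Cons_0:
  assumes "S \<subseteq> X" "c \<in> X" "\<And>T. T \<subseteq> X \<Longrightarrow> cexp T w \<approx> 0"
  shows "cexp S (c # w) \<approx> 0"
  unfolding wcoeff.simps using assms
  by (intro eqv_sum_0 eqv_mult_0 eqv_Q_power eqv_a assms(3)) auto

lemma cexp_swap:
  assumes "S \<subseteq> X" "set w \<subseteq> X" "k \<in> X" "l \<in> X" "k < l"
  shows "cexp S (l # k # w) \<approx> Q * cexp S (k # l # w)"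
proof -
  have S: "finite S" using assms(1) finite_X finite_subset by blast
  let ?P = "{(i, j). i \<in> S \<and> j \<in> S \<and> i < j}"
  have "(a i l * a j k + Q * (a j l * a i k)) * cexp (S - {i, j}) w \<approx>
      Q * (a i k * a j l + Q * (a j k * a i l)) * cexp (S - {i, j}) w" if "(i, j) \<in> ?P" for i j
    using assms that by (intro eqv_mult rel_cross cexp_refl) auto
  then have "cexp S (l # k # w) \<approx> (\<Sum>(i, j)\<in>?P. Q ^ (below S i + below (S - {i}) j) *
      (Q * (a i k * a j l + Q * (a j k * a i l)) * cexp (S - {i, j}) w))"
    unfolding wcoeff_Cons_Cons[OF Q_central S]
    by (intro eqv_sum) (auto intro!: eqv_mult[OF eqv_Q_power])
  also have "\<dots> = Q * cexp S (k # l # w)"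
    unfolding wcoeff_Cons_Cons[OF Q_central S] sum_distrib_left
    by (rule sum.cong) (auto simp: mult.assoc power_central[of Q Q, OF Q_central])
  finally show ?thesis .
qed

lemma cexp_repeat:
  assumes "S \<subseteq> X" "set w \<subseteq> X" "k \<in> X"
  shows "cexp S (k # k # w) \<approx> 0"
proof -
  have S: "finite S" using assms(1) finite_X finite_subset by blast
  have "(a i k * a j k + Q * (a j k * a i k)) * cexp (S - {i, j}) w \<approx> 0"
    if "i \<in> S" "j \<in> S" "i < j" for i j
    using eqv_mult[OF rel_col[of i j k] cexp_refl[of "S - {i, j}" w]] assms that by auto
  then show ?thesis
    unfolding wcoeff_Cons_Cons[OF Q_central S]
    by (intro eqv_sum_0) (auto intro!: eqv_mult_0[OF eqv_Q_power])
qed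

text \<open>The column c moves to the right past each smaller entry at the cost of one Q. Only
  descending pairs are swapped, so no inverse of Q appears.\<close>

lemma cexp_insort:
  assumes "sorted_wrt (<) w" "set w \<subseteq> X" "c \<in> X" "S \<subseteq> X" "c \<notin> set w"
  shows "cexp S (c # w) \<approx> Q ^ below (set w) c * cexp S (insort c w)"
  using assms
proof (induction w arbitrary: S)
  case Nil
  then show ?case using cexp_refl[of S "[c]"] by (simp add: below_def)
next
  case (Cons d w)
  show ?case
  proof (cases "c < d")
    case True
    then have "below (set (d # w)) c = 0"
      using Cons.prems by (intro below_eq_0) auto
    then show ?thesis
      using True cexp_refl[of S "c # d # w"] Cons.prems by simp
  next
    case False
    then have d: "d < c" using Cons.prems by simp
    have "d \<notin> set w" using Cons.prems by auto
    then have b: "below (set (d # w)) c = Suc (below (set w) c)"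
      using d by (simp add: below_insert)
    have "cexp S (c # d # w) \<approx> Q * cexp S (d # c # w)"
      using Cons.prems d by (intro cexp_swap) auto
    also have "Q * cexp S (d # c # w) \<approx> Q * (Q ^ below (set w) c * cexp S (d # insort c w))"
      using Cons.prems by (intro eqv_mult[OF eqv_Q] cexp_Cons_cong Cons.IH) auto
    finally show ?thesis
      using d b by (simp add: mult.assoc)
  qed
qed

text \<open>Here c moves to the right until it stands next to its own copy, where
  \<open>cexp_repeat\<close> applies.\<close>

lemma cexp_member:
  assumes "sorted_wrt (<) w" "set w \<subseteq> X" "S \<subseteq> X" "c \<in> set w"
  shows "cexp S (c # w) \<approx> 0"
  using assms
proof (induction w arbitrary: S)
  case (Cons d w)
  show ?case
  proof (cases "c = d")
    case True
    then show ?thesis using Cons.prems cexp_repeat by simp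
  next
    case False
    then have d: "d < c" "c \<in> set w" using Cons.prems by auto
    then have "cexp S (c # d # w) \<approx> Q * cexp S (d # c # w)"
      using Cons.prems by (intro cexp_swap) auto
    also have "Q * cexp S (d # c # w) \<approx> 0"
      using Cons.prems d by (intro eqv_mult_0 eqv_Q cexp_Cons_0 Cons.IH) auto
    finally show ?thesis .
  qed
qed simp

text \<open>The letters of w are inserted starting with the last. When k is inserted, the later
  letters of w are all larger and cost nothing, so only the smaller elements of L count.\<close>

lemma cexp_append_disjoint:
  assumes "sorted_wrt (<) w" "set w \<subseteq> X" "L \<subseteq> X" "S \<subseteq> X" "set w \<inter> L = {}"
  shows "cexp S (w @ sorted_list_of_set L) \<approx> Q ^ cross_inv (set w) L * cdet S (set w \<union> L)"
  using assms
proof (induction w arbitrary: S)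
  case Nil
  then have "finite L" using finite_X finite_subset by blast
  with Nil show ?case
    using cexp_refl[of S "sorted_list_of_set L"] by (simp add: cross_inv_def column_minor_def)
next
  case (Cons k w)
  let ?u = "sorted_list_of_set (set w \<union> L)"
  have L: "finite L" using Cons.prems finite_X finite_subset by blast
  have notin: "k \<notin> set w" using Cons.prems by auto
  have "cexp S (k # (w @ sorted_list_of_set L)) \<approx> Q ^ cross_inv (set w) L * cexp S (k # ?u)"
    using Cons.prems by (intro cexp_Cons_cong) (auto simp: column_minor_def[symmetric] intro!: Cons.IH)
  also have "Q ^ cross_inv (set w) L * cexp S (k # ?u) \<approx>
      Q ^ cross_inv (set w) L * (Q ^ below (set ?u) k * cexp S (insort k ?u))"
    using Cons.prems L by (intro eqv_mult eqv_Q_power cexp_insort) auto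
  also have "insort k ?u = sorted_list_of_set (insert k (set w \<union> L))"
    using Cons.prems L by (subst sorted_list_of_set_insert) auto
  also have "below (set ?u) k = below (set w) k + below L k"
    using Cons.prems L by (simp add: below_Un_disjoint)
  also have "below (set w) k = 0"
    using Cons.prems by (intro below_eq_0) auto
  also have "Q ^ cross_inv (set w) L * (Q ^ (0 + below L k) *
      cexp S (sorted_list_of_set (insert k (set w \<union> L)))) =
      Q ^ cross_inv (set (k # w)) L * cdet S (set (k # w) \<union> L)"
    using notin by (simp add: cross_inv_def column_minor_def power_add mult.assoc Q_power_left_commute)
  finally show ?case by simp
qed

lemma cexp_append_meet:
  assumes "sorted_wrt (<) w" "set w \<subseteq> X" "L \<subseteq> X" "S \<subseteq> X" "set w \<inter> L \<noteq> {}"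
  shows "cexp S (w @ sorted_list_of_set L) \<approx> 0"
  using assms
proof (induction w arbitrary: S)
  case (Cons k w)
  let ?u = "sorted_list_of_set (set w \<union> L)"
  have L: "finite L" using Cons.prems finite_X finite_subset by blast
  show ?case
  proof (cases "set w \<inter> L = {}")
    case True
    \<comment> \<open>The only common column is now k itself. Once the tail is sorted, it contains k
      and \<open>cexp_member\<close> applies.\<close>
    have "cexp S (k # (w @ sorted_list_of_set L)) \<approx> Q ^ cross_inv (set w) L * cexp S (k # ?u)"
      using Cons.prems True
      by (intro cexp_Cons_cong) (auto simp: column_minor_def[symmetric] intro!: cexp_append_disjoint)
    also have "\<dots> \<approx> 0"
      using Cons.prems True L by (intro eqv_mult_0 eqv_Q_power cexp_member) auto
    finally show ?thesis by simp
  next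
    case False
    then have "cexp S (k # (w @ sorted_list_of_set L)) \<approx> 0"
      using Cons.prems by (intro cexp_Cons_0 Cons.IH) auto
    then show ?thesis by simp
  qed
qed simp

section \<open>Row-ordered minors and their Laplace expansion\<close>

lemma rdet_refl: "S \<subseteq> X \<Longrightarrow> K \<subseteq> X \<Longrightarrow> rdet S K \<approx> rdet S K"
proof (induction "card S" arbitrary: S K)
  case 0
  then have "S = {}" using finite_X finite_subset by fastforce
  then show ?case by (simp add: row_minor_def eqv_0 eqv_1)
next
  case (Suc n)
  have S: "finite S" "S \<noteq> {}" using Suc finite_X finite_subset by fastforce+
  have "Min S \<in> S" using S by simp
  then have "rdet (S - {Min S}) (K - {j}) \<approx> rdet (S - {Min S}) (K - {j})" for j
    using Suc S by (intro Suc.hyps(1)) auto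
  then show ?case
    using Suc.prems \<open>Min S \<in> S\<close>
    by (auto simp: row_minor_def sorted_list_of_set_nonempty[OF S] intro!: eqv_sum eqv_mult eqv_Q_power eqv_a)
qed

text \<open>
  Both determinants are expanded twice, along the first row and the first column. The two double
  expansions differ only by the order of the entries \<open>a i k\<^sub>0\<close> and \<open>a s\<^sub>0 j\<close>, which commute.
\<close>

lemma cdet_eqv_rdet: "S \<subseteq> X \<Longrightarrow> K \<subseteq> X \<Longrightarrow> cdet S K \<approx> rdet S K"
proof (induction "card S" arbitrary: S K rule: less_induct)
  case less
  have S: "finite S" and K: "finite K" using less finite_X finite_subset by blast+
  show ?case
  proof (cases "S = {} \<or> K = {}")
    case True
    then show ?thesis
      using S K by (auto simp: column_minor_def row_minor_def eqv_0 eqv_1 sorted_list_of_set_nonempty)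
  next
    case False
    then have ne: "S \<noteq> {}" "K \<noteq> {}" by auto
    define s k S' K' where "s = Min S" and "k = Min K" and "S' = S - {s}" and "K' = K - {k}"
    have sk: "s \<in> S" "k \<in> K" using S K ne by (auto simp: s_def k_def)
    have s_less: "s < i" if "i \<in> S'" for i
      using that S Min_less unfolding S'_def s_def by blast
    have k_less: "k < j" if "j \<in> K'" for j
      using that K Min_less unfolding K'_def k_def by blast
    have dec: "S = insert s S'" "s \<notin> S'" "K = insert k K'" "k \<notin> K'"
      and fin: "finite S'" "finite K'"
      using sk S K by (auto simp: S'_def K'_def)
    have sub: "S' \<subseteq> X" "K' \<subseteq> X" "s \<in> X" "k \<in> X" using less.prems sk by (auto simp: S'_def K'_def)
    have card: "card S' < card S" using dec(1,2) fin by simp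
    have cd: "cdet T K = (\<Sum>i\<in>T. Q ^ below T i * (a i k * cdet (T - {i}) K'))" for T
      unfolding column_minor_def sorted_list_of_set_nonempty[OF K ne(2)] k_def K'_def by simp
    have rd: "rdet (insert s T) L = (\<Sum>j\<in>L. Q ^ below L j * (a s j * rdet T (L - {j})))"
      if "T \<subseteq> S'" for T L
    proof -
      have "sorted_list_of_set (insert s T) = s # sorted_list_of_set T"
        using that s_less finite_subset[OF that fin(1)] by (intro sorted_list_of_set_insert_less) auto
      then show ?thesis
        by (simp add: row_minor_def del: sorted_list_of_set_insert_remove)
    qed
    have below: "below S s = 0" "below K k = 0"
      "\<And>i. i \<in> S' \<Longrightarrow> below S i = Suc (below S' i)" "\<And>j. j \<in> K' \<Longrightarrow> below K j = Suc (below K' j)"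
      using s_less k_less dec fin
      by (auto simp: below_insert intro!: below_eq_0) (auto simp: less_imp_le)
    have "cdet S K = a s k * cdet S' K' +
        (\<Sum>i\<in>S'. Q ^ Suc (below S' i) * (a i k * cdet (S - {i}) K'))"
      unfolding cd sum.remove[OF S sk(1)] S'_def[symmetric] using below by simp
    also have "\<dots> \<approx> a s k * rdet S' K' +
        (\<Sum>i\<in>S'. Q ^ Suc (below S' i) * (a i k * rdet (S - {i}) K'))"
      using sub less.prems card S
      by (intro eqv_add eqv_mult eqv_sum eqv_Q_power eqv_a less.hyps)
        (auto simp: S'_def intro!: psubset_card_mono)
    also have "\<dots> = a s k * rdet S' K' +
        (\<Sum>i\<in>S'. \<Sum>j\<in>K'. Q ^ Suc (below S' i + below K' j) *
          (a i k * a s j * rdet (S' - {i}) (K' - {j})))"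
    proof -
      have "rdet (S - {i}) K' = (\<Sum>j\<in>K'. Q ^ below K' j * (a s j * rdet (S' - {i}) (K' - {j})))"
        if "i \<in> S'" for i
      proof -
        have "S - {i} = insert s (S' - {i})" using that dec by auto
        then show ?thesis by (simp add: rd)
      qed
      then show ?thesis
        by (simp add: sum_distrib_left power_add mult.assoc Q_power_central)
    qed
    also have "\<dots> \<approx> a s k * rdet S' K' +
        (\<Sum>i\<in>S'. \<Sum>j\<in>K'. Q ^ Suc (below S' i + below K' j) *
          (a s j * a i k * rdet (S' - {i}) (K' - {j})))"
      using sub s_less k_less
      by (intro eqv_add eqv_mult eqv_sum eqv_Q_power eqv_a rdet_refl rel_comm) auto
    also have "\<dots> = a s k * rdet S' K' +
        (\<Sum>j\<in>K'. Q ^ Suc (below K' j) * (a s j *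
          (\<Sum>i\<in>S'. Q ^ below S' i * (a i k * rdet (S' - {i}) (K' - {j})))))"
      by (subst sum.swap)
        (simp add: sum_distrib_left power_add mult.assoc Q_power_central add.commute)
    \<comment> \<open>Going back to column order turns the inner sum into the first-column expansion
      of a minor with columns K - {j}: its least column is still k, because j is in K'.\<close>
    also have "\<dots> \<approx> a s k * rdet S' K' +
        (\<Sum>j\<in>K'. Q ^ Suc (below K' j) * (a s j *
          (\<Sum>i\<in>S'. Q ^ below S' i * (a i k * cdet (S' - {i}) (K' - {j})))))"
      using sub card fin
      by (intro eqv_add eqv_mult eqv_sum eqv_Q_power eqv_a rdet_refl eqv_sym[OF less.hyps])
        (auto intro: le_less_trans[OF card_mono])
    also have "\<dots> = a s k * rdet S' K' +
        (\<Sum>j\<in>K'. Q ^ Suc (below K' j) * (a s j * cdet S' (K - {j})))"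
    proof -
      have "cdet S' (K - {j}) = (\<Sum>i\<in>S'. Q ^ below S' i * (a i k * cdet (S' - {i}) (K' - {j})))"
        if "j \<in> K'" for j
      proof -
        have "K - {j} = insert k (K' - {j})" using that dec by auto
        then have "sorted_list_of_set (K - {j}) = k # sorted_list_of_set (K' - {j})"
          using k_less fin sorted_list_of_set_insert_less[of "K' - {j}" k] by simp
        then show ?thesis by (simp add: column_minor_def)
      qed
      then show ?thesis by simp
    qed
    also have "\<dots> \<approx> a s k * rdet S' K' +
        (\<Sum>j\<in>K'. Q ^ Suc (below K' j) * (a s j * rdet S' (K - {j})))"
      using sub card less.prems
      by (intro eqv_add eqv_mult eqv_sum eqv_Q_power eqv_a rdet_refl less.hyps) auto
    also have "\<dots> = rdet S K"
      unfolding rd[of S' K, OF subset_refl, folded dec(1)] sum.remove[OF K sk(2)] K'_def[symmetric]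
      using below by simp
    finally show ?thesis .
  qed
qed

text \<open>In column order the left side is the coefficient of one concatenated word, by
  \<open>wcoeff_append\<close>. The relations then sort that word or make it vanish; the row form is
  left before this and restored after it.\<close>

lemma rdet_laplace:
  assumes "S \<subseteq> X" "K \<subseteq> X" "L \<subseteq> X"
  shows "(\<Sum>I\<in>{I. I \<subseteq> S \<and> card I = card K}. Q ^ cross_inv I (S - I) * (rdet I K * rdet (S - I) L)) \<approx>
    (if K \<inter> L = {} then Q ^ cross_inv K L * rdet S (K \<union> L) else 0)"
proof -
  have fin: "finite S" "finite K" using assms finite_X finite_subset by blast+
  let ?f = "\<lambda>I. Q ^ cross_inv I (S - I) * (cdet I K * cdet (S - I) L)"
  have "(\<Sum>I\<in>{I. I \<subseteq> S \<and> card I = card K}. Q ^ cross_inv I (S - I) * (rdet I K * rdet (S - I) L)) \<approx>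
      sum ?f {I. I \<subseteq> S \<and> card I = card K}"
    using assms by (intro eqv_sum eqv_mult eqv_Q_power eqv_sym[OF cdet_eqv_rdet]) auto
  \<comment> \<open>By homogeneity the row sets of any other size contribute nothing, so the sum may
    run over all subsets as in \<open>wcoeff_append\<close>.\<close>
  also have "sum ?f {I. I \<subseteq> S \<and> card I = card K} = sum ?f (Pow S)"
    using fin by (intro sum.mono_neutral_left)
      (auto simp: column_minor_def intro!: wcoeff_eq_0[THEN arg_cong[where f = "\<lambda>x. _ * (x * _)"], THEN trans]
        intro: finite_subset)
  also have "\<dots> = cexp S (sorted_list_of_set K @ sorted_list_of_set L)"
    using fin by (simp add: wcoeff_append[OF Q_central] column_minor_def)
  also have "\<dots> \<approx> (if K \<inter> L = {} then Q ^ cross_inv K L * cdet S (K \<union> L) else 0)"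
    using assms fin cexp_append_disjoint[of "sorted_list_of_set K" L S]
      cexp_append_meet[of "sorted_list_of_set K" L S] by auto
  also have "\<dots> \<approx> (if K \<inter> L = {} then Q ^ cross_inv K L * rdet S (K \<union> L) else 0)"
    using assms by (auto intro!: eqv_mult eqv_Q_power eqv_0 cdet_eqv_rdet)
  finally show ?thesis .
qed

end

section \<open>Minors on unions of column blocks\<close>

text \<open>Blocks are counted from 1, in the half-open form of the column lists in the theorem. By
  truncated subtraction block 0 is empty, so statements about sizes have to exclude the index
  0.\<close>

definition block :: "nat \<Rightarrow> nat \<Rightarrow> nat set" where
  "block m c = {m * (c - 1) + 1..<m * c + 1}"

definition blocks :: "nat \<Rightarrow> nat set \<Rightarrow> nat set" where
  "blocks m D = (\<Union>c\<in>D. block m c)"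

lemma finite_block [simp]: "finite (block m c)"
  by (simp add: block_def)

lemma finite_blocks: "finite D \<Longrightarrow> finite (blocks m D)"
  by (simp add: blocks_def)

lemma card_block: "1 \<le> c \<Longrightarrow> card (block m c) = m"
  by (cases c) (simp_all add: block_def)

lemma block_less:
  assumes "c < d" "i \<in> block m c" "j \<in> block m d"
  shows "i < j"
proof -
  have "m * c \<le> m * (d - 1)" using assms(1) by (intro mult_le_mono2) simp
  moreover have "i < m * c + 1" "m * (d - 1) + 1 \<le> j"
    using assms by (simp_all only: block_def atLeastLessThan_iff)
  ultimately show ?thesis by linarith
qed

lemma block_disjoint: "c \<noteq> d \<Longrightarrow> block m c \<inter> block m d = {}"
  using block_less[of c d _ m] block_less[of d c _ m] by (metis disjoint_iff less_irrefl nat_neq_iff)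

lemma block_blocks_disjoint:
  assumes "c \<notin> D"
  shows "block m c \<inter> blocks m D = {}"
proof -
  have "block m c \<inter> block m d = {}" if "d \<in> D" for d
    using that assms by (intro block_disjoint) auto
  then show ?thesis
    unfolding blocks_def by blast
qed

lemma blocks_insert: "blocks m (insert c D) = block m c \<union> blocks m D"
  by (simp add: blocks_def)

text \<open>Each block of D lies entirely to one side of j, so it contributes m or nothing.\<close>

lemma below_blocks:
  assumes "finite D" "D \<subseteq> {1..}" "c \<notin> D" "j \<in> block m c"
  shows "below (blocks m D) j = m * below D c"
  using assms
proof (induction D rule: finite_induct)
  case empty
  then show ?case by (simp add: blocks_def below_def)
next
  case (insert d D)
  have "below (block m d) j = (if d < c then m else 0)"
  proof (cases "d < c")
    case True
    then have "below (block m d) j = card (block m d)"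
      using insert.prems block_less by (intro below_eq_card) blast
    then show ?thesis using True insert.prems by (simp add: card_block)
  next
    case False
    then have "c < d" using insert.prems by auto
    then have "below (block m d) j = 0"
      using insert.prems block_less by (intro below_eq_0) (blast intro: less_imp_le)
    then show ?thesis using False by simp
  qed
  moreover have "below (blocks m (insert d D)) j = below (block m d) j + below (blocks m D) j"
    unfolding blocks_insert using insert block_blocks_disjoint
    by (intro below_Un_disjoint) (auto simp: finite_blocks)
  ultimately show ?case
    using insert by (simp add: below_insert)
qed

section \<open>One step of the recursion on unions of blocks\<close>

context quantum_matrix_congruence
begin

lemma rdet_insert_less:
  assumes "finite S" "\<And>i. i \<in> S \<Longrightarrow> s < i"
  shows "rdet (insert s S) K = (\<Sum>j\<in>K. Q ^ below K j * (a s j * rdet S (K - {j})))"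
proof -
  have "sorted_list_of_set (insert s S) = s # sorted_list_of_set S"
    using assms by (rule sorted_list_of_set_insert_less)
  then show ?thesis
    by (simp add: row_minor_def del: sorted_list_of_set_insert_remove)
qed

text \<open>
  Moving the block \<open>c\<close> without its entry \<open>j\<close> past the \<open>r\<close> smaller blocks of \<open>C\<close> costs
  \<open>Q ^ ((m - 1) * m * r)\<close>, while the position of \<open>j\<close> in the union of all blocks differs from its
  position in its own block by \<open>m * r\<close> only. The assumption on \<open>Q\<close> absorbs the difference.
\<close>

lemma rdet_blocks_step:
  assumes S: "S \<subseteq> X" "s \<in> X" "\<And>i. i \<in> S \<Longrightarrow> s < i"
    and sub: "blocks m {1..n} \<subseteq> X" and m: "2 \<le> m" and root: "Q ^ (m * (m - 2)) = 1"
  shows "(\<Sum>I\<in>{I. I \<subseteq> S \<and> card I = m - 1}. Q ^ cross_inv I (S - I) *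
      ((\<Sum>c\<in>{1..n}. rdet (insert s I) (block m c)) *
       (\<Sum>C\<in>{C. C \<subseteq> {1..n} \<and> card C = p}. rdet (S - I) (blocks m C)))) \<approx>
    (\<Sum>D\<in>{D. D \<subseteq> {1..n} \<and> card D = Suc p}. rdet (insert s S) (blocks m D))"
proof -
  let ?II = "{I. I \<subseteq> S \<and> card I = m - 1}" and ?CC = "{C. C \<subseteq> {1..n} \<and> card C = p}"
  let ?DD = "{D. D \<subseteq> {1..n} \<and> card D = Suc p}"
  let ?g = "\<lambda>D j. Q ^ below (blocks m D) j * (a s j * rdet S (blocks m D - {j}))"
  have fS: "finite S" using S finite_X finite_subset by blast
  have fC: "finite C" if "C \<subseteq> {1..n}" for C using that by (rule finite_subset) simp
  have sub': "blocks m C \<subseteq> X" if "C \<subseteq> {1..n}" for C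
    using that sub by (auto simp: blocks_def)
  have sub1: "block m c \<subseteq> X" if "c \<in> {1..n}" for c
    using that sub unfolding blocks_def by blast
  have "(\<Sum>I\<in>?II. Q ^ cross_inv I (S - I) * ((\<Sum>c\<in>{1..n}. rdet (insert s I) (block m c)) *
       (\<Sum>C\<in>?CC. rdet (S - I) (blocks m C)))) =
     (\<Sum>I\<in>?II. \<Sum>c\<in>{1..n}. \<Sum>C\<in>?CC. \<Sum>j\<in>block m c. Q ^ below (block m c) j * (a s j *
       (Q ^ cross_inv I (S - I) * (rdet I (block m c - {j}) * rdet (S - I) (blocks m C)))))"
  proof (rule sum.cong)
    fix I assume I: "I \<in> ?II"
    then have "finite I" "\<And>i. i \<in> I \<Longrightarrow> s < i" using fS finite_subset S by auto
    then show "Q ^ cross_inv I (S - I) * ((\<Sum>c\<in>{1..n}. rdet (insert s I) (block m c)) *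
       (\<Sum>C\<in>?CC. rdet (S - I) (blocks m C))) =
      (\<Sum>c\<in>{1..n}. \<Sum>C\<in>?CC. \<Sum>j\<in>block m c. Q ^ below (block m c) j * (a s j *
       (Q ^ cross_inv I (S - I) * (rdet I (block m c - {j}) * rdet (S - I) (blocks m C)))))"
      unfolding sum_product
      by (simp add: rdet_insert_less sum_distrib_left sum_distrib_right mult.assoc
        Q_power_central Q_power_left_commute[of "cross_inv I (S - I)"])
  qed simp
  \<comment> \<open>With the row s and its column j pulled out, the sum over I can be moved
    innermost, where it is the left side of \<open>rdet_laplace\<close>.\<close>
  also have "\<dots> = (\<Sum>c\<in>{1..n}. \<Sum>C\<in>?CC. \<Sum>j\<in>block m c. Q ^ below (block m c) j * (a s j *
       (\<Sum>I\<in>?II. Q ^ cross_inv I (S - I) * (rdet I (block m c - {j}) * rdet (S - I) (blocks m C)))))"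
    unfolding sum_distrib_left
    by (subst sum.swap, rule sum.cong, simp, subst sum.swap, rule sum.cong, simp, subst sum.swap) simp
  also have "\<dots> \<approx> (\<Sum>c\<in>{1..n}. \<Sum>C\<in>?CC. \<Sum>j\<in>block m c. if c \<in> C then 0 else ?g (insert c C) j)"
  proof (intro eqv_sum)
    fix c C j assume c: "c \<in> {1..n}" and C: "C \<in> ?CC" and j: "j \<in> block m c"
    let ?K = "block m c - {j}"
    have K: "card ?K = m - 1" using c j by (simp add: card_block)
    let ?R = "if ?K \<inter> blocks m C = {} then
        Q ^ cross_inv ?K (blocks m C) * rdet S (?K \<union> blocks m C) else 0"
    have "?K \<subseteq> X" "blocks m C \<subseteq> X" using c C sub1 sub' by blast+
    then have "(\<Sum>I\<in>?II. Q ^ cross_inv I (S - I) * (rdet I ?K * rdet (S - I) (blocks m C))) \<approx> ?R"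
      using rdet_laplace[OF S(1), of ?K "blocks m C"] by (simp only: K)
    then have "Q ^ below (block m c) j * (a s j * (\<Sum>I\<in>?II. Q ^ cross_inv I (S - I) *
        (rdet I ?K * rdet (S - I) (blocks m C)))) \<approx> Q ^ below (block m c) j * (a s j * ?R)"
      using subsetD[OF sub1[OF c] j] S(2) by (intro eqv_mult eqv_Q_power eqv_a)
    also have "\<dots> = (if c \<in> C then 0 else ?g (insert c C) j)"
    proof (cases "c \<in> C")
      case True
      \<comment> \<open>Removing j from a block of at least two columns leaves a column, and for c
        in C that column occurs in both factors.\<close>
      have "card ?K \<noteq> 0" using K m by linarith
      then have "?K \<noteq> {}" by (metis card.empty)
      then have "?K \<inter> blocks m C \<noteq> {}" using True by (auto simp: blocks_def)
      then show ?thesis using True by simp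
    next
      case False
      let ?r = "below C c"
      have disj: "block m c \<inter> blocks m C = {}" using False by (rule block_blocks_disjoint)
      have b: "below (blocks m C) i = m * ?r" if "i \<in> block m c" for i
        using that C False fC by (intro below_blocks) auto
      have "cross_inv ?K (blocks m C) = (m - 1) * (m * ?r)"
        by (simp add: cross_inv_def b K)
      also have "\<dots> = m * ?r + m * (m - 2) * ?r"
        using m by (auto simp: algebra_simps dest!: le_Suc_ex)
      finally have "Q ^ cross_inv ?K (blocks m C) = Q ^ (m * ?r)"
        by (simp only: power_add power_mult[of Q "m * (m - 2)"] root power_one mult_1_right)
      moreover have "below (blocks m (insert c C)) j = below (block m c) j + m * ?r"
        unfolding blocks_insert using disj C fC j b
        by (subst below_Un_disjoint) (auto simp: finite_blocks)
      moreover have "blocks m (insert c C) - {j} = ?K \<union> blocks m C"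
        unfolding blocks_insert using disj j by auto
      moreover have "?K \<inter> blocks m C = {}" using disj by auto
      ultimately show ?thesis
        using False by (simp add: Q_power_central power_add mult.assoc)
    qed
    finally show "Q ^ below (block m c) j * (a s j * (\<Sum>I\<in>?II. Q ^ cross_inv I (S - I) *
        (rdet I ?K * rdet (S - I) (blocks m C)))) \<approx> (if c \<in> C then 0 else ?g (insert c C) j)" .
  qed
  also have "(\<Sum>c\<in>{1..n}. \<Sum>C\<in>?CC. \<Sum>j\<in>block m c. if c \<in> C then 0 else ?g (insert c C) j) =
      (\<Sum>c\<in>{1..n}. \<Sum>C\<in>{C\<in>?CC. c \<notin> C}. \<Sum>j\<in>block m c. ?g (insert c C) j)"
    by (rule sum.cong[OF refl], rule sum.mono_neutral_cong_right) auto
  also have "\<dots> = (\<Sum>(c, C)\<in>(SIGMA c:{1..n}. {C\<in>?CC. c \<notin> C}). \<Sum>j\<in>block m c. ?g (insert c C) j)"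
    by (subst sum.Sigma) auto
  \<comment> \<open>A block c together with a set C avoiding it is the same as a set D =
    \<open>insert c C\<close> with a marked element c.\<close>
  also have "\<dots> = (\<Sum>(D, c)\<in>(SIGMA D:?DD. D). \<Sum>j\<in>block m c. ?g D j)"
    by (rule sum.reindex_bij_witness[where i = "\<lambda>(D, c). (c, D - {c})" and j = "\<lambda>(c, C). (insert c C, c)"])
      (auto simp: insert_absorb finite_subset[of _ "{Suc 0..n}"])
  also have "\<dots> = (\<Sum>D\<in>?DD. \<Sum>c\<in>D. \<Sum>j\<in>block m c. ?g D j)"
    by (rule sum.Sigma[symmetric]) (auto intro: finite_subset[of _ "{Suc 0..n}"])
  \<comment> \<open>Choosing a block of D and a column j in it amounts to choosing a column of the
    union, which completes the expansion along row s.\<close>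
  also have "\<dots> = (\<Sum>D\<in>?DD. \<Sum>j\<in>blocks m D. ?g D j)"
  proof (rule sum.cong)
    fix D assume "D \<in> ?DD"
    then show "(\<Sum>c\<in>D. \<Sum>j\<in>block m c. ?g D j) = (\<Sum>j\<in>blocks m D. ?g D j)"
      using fC block_disjoint unfolding blocks_def
      by (intro sum.UNION_disjoint[symmetric]) auto
  qed simp
  also have "\<dots> = (\<Sum>D\<in>?DD. rdet (insert s S) (blocks m D))"
    using fS S(3) by (simp add: rdet_insert_less)
  finally show ?thesis .
qed

end

section \<open>Minors as sums over permutations\<close>

primrec list_inversions :: "nat list \<Rightarrow> nat" where
  "list_inversions [] = 0"
| "list_inversions (x # xs) = below (set xs) x + list_inversions xs"

lemma list_inversions_eq_card:
  "distinct xs \<Longrightarrow> list_inversions xs = card {(t, u). t < u \<and> u < length xs \<and> xs ! t > xs ! u}"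
proof (induction xs)
  case (Cons x xs)
  let ?A = "{u. u < length xs \<and> xs ! u < x}"
  let ?B = "{(t, u). t < u \<and> u < length xs \<and> xs ! t > xs ! u}"
  have fB: "finite ?B"
    by (rule finite_subset[of _ "{..<length xs} \<times> {..<length xs}"]) auto
  have im: "(!) xs ` ?A = {y \<in> set xs. y < x}"
    by (auto simp: in_set_conv_nth)
  have "inj_on ((!) xs) ?A"
    using Cons.prems by (auto intro: inj_on_nth)
  then have A: "below (set xs) x = card ?A"
    using card_image[of "(!) xs" ?A] by (simp add: im below_def)
  \<comment> \<open>The inversions are split by whether their left position is 0; the others are
    inversions of the tail, shifted by one.\<close>
  have L: "{(t, u). t < u \<and> u < length (x # xs) \<and> (x # xs) ! t > (x # xs) ! u} =
      (\<lambda>u. (0, Suc u)) ` ?A \<union> (\<lambda>(t, u). (Suc t, Suc u)) ` ?B" (is "?L = ?R")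
  proof (intro Set.set_eqI iffI)
    fix p assume "p \<in> ?L"
    then obtain t u where p: "p = (t, Suc u)" "t < Suc u" "u < length xs" "(x # xs) ! t > xs ! u"
      by (auto simp: less_Suc_eq_0_disj)
    show "p \<in> ?R" using p by (cases t) (auto simp: image_iff)
  next
    fix p assume "p \<in> ?R"
    then show "p \<in> ?L" by (elim UnE imageE) auto
  qed
  have "card ?R = card ?A + card ?B"
    using fB by (subst card_Un_disjoint) (auto simp: card_image inj_on_def)
  then show ?case
    using A Cons.IH Cons.prems by (simp only: L list_inversions.simps distinct.simps)
qed simp

text \<open>Iterating the first-row expansion picks a column for each row in turn, that is, an
  arrangement of K. The power of Q at each stage counts the inversions that begin with the column
  just picked.\<close>

lemma wcoeff_transpose_eq_sum_permutations:
  fixes Q :: "'a::ring_1"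
  assumes Q: "\<And>x. Q * x = x * Q"
  shows "finite K \<Longrightarrow> card K = length is \<Longrightarrow> wcoeff Q (\<lambda>i j. a j i) K is =
    (\<Sum>xs\<in>permutations_of_set K. Q ^ list_inversions xs * prod_list (map2 a is xs))"
proof (induction "is" arbitrary: K)
  case (Cons i "is")
  have ne: "K \<noteq> {}" using Cons.prems by auto
  let ?P = "\<lambda>x. permutations_of_set (K - {x})"
  have "(\<Sum>xs\<in>permutations_of_set K. Q ^ list_inversions xs * prod_list (map2 a (i # is) xs)) =
      (\<Sum>x\<in>K. \<Sum>xs\<in>(#) x ` ?P x. Q ^ list_inversions xs * prod_list (map2 a (i # is) xs))"
    unfolding permutations_of_set_nonempty[OF ne] using Cons.prems
    by (subst sum.UNION_disjoint) auto
  also have "\<dots> = (\<Sum>x\<in>K. \<Sum>xs\<in>?P x. Q ^ below K x *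
      (a i x * (Q ^ list_inversions xs * prod_list (map2 a is xs))))"
  proof (rule sum.cong)
    fix x assume x: "x \<in> K"
    have "below (set xs) x = below K x" if "xs \<in> ?P x" for xs
      using below_remove[of K x x] x Cons.prems permutations_of_setD(1)[OF that] by simp
    then show "(\<Sum>xs\<in>(#) x ` ?P x. Q ^ list_inversions xs * prod_list (map2 a (i # is) xs)) =
      (\<Sum>xs\<in>?P x. Q ^ below K x * (a i x * (Q ^ list_inversions xs * prod_list (map2 a is xs))))"
      by (subst sum.reindex) (auto simp: power_add mult.assoc power_central[OF Q, of "a _ _"])
  qed simp
  also have "\<dots> = wcoeff Q (\<lambda>i j. a j i) K (i # is)"
    using Cons.prems by (simp add: sum_distrib_left Cons.IH)
  finally show ?case by simp
qed simp

text \<open>Distinct entries give injectivity; surjectivity follows by counting, since both sides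
  have a factorial number of elements.\<close>

lemma bij_betw_permutes_permutations_of_set:
  assumes "distinct js"
  shows "bij_betw (\<lambda>\<sigma>. map (\<lambda>t. js ! \<sigma> t) [0..<length js])
    {\<sigma>. \<sigma> permutes {..<length js}} (permutations_of_set (set js))"
proof -
  let ?n = "length js"
  let ?f = "\<lambda>\<sigma>. map (\<lambda>t. js ! \<sigma> t) [0..<?n]"
  have lt: "\<sigma> t < ?n" if "\<sigma> permutes {..<?n}" "t < ?n" for \<sigma> t
    using permutes_in_image[OF that(1), of t] that(2) by simp
  have inj: "inj_on ?f {\<sigma>. \<sigma> permutes {..<?n}}"
  proof (rule inj_onI, rule ext)
    fix \<sigma> \<tau> t assume *: "\<sigma> \<in> {\<sigma>. \<sigma> permutes {..<?n}}" "\<tau> \<in> {\<sigma>. \<sigma> permutes {..<?n}}" "?f \<sigma> = ?f \<tau>"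
    show "\<sigma> t = \<tau> t"
    proof (cases "t < ?n")
      case True
      then have "js ! \<sigma> t = js ! \<tau> t" using *(3) by simp
      then show ?thesis
        using * lt[of \<sigma> t] lt[of \<tau> t] True nth_eq_iff_index_eq[OF assms, of "\<sigma> t" "\<tau> t"]
        by blast
    next
      case False
      then show ?thesis using * by (auto simp: permutes_def)
    qed
  qed
  have "?f \<sigma> \<in> permutations_of_set (set js)" if s: "\<sigma> permutes {..<?n}" for \<sigma>
  proof (rule permutations_of_setI)
    have "set (?f \<sigma>) = (!) js ` (\<sigma> ` {..<?n})" by (auto simp: image_image)
    also have "\<dots> = set js" using permutes_image[OF s] by (auto simp: set_conv_nth)
    finally show "set (?f \<sigma>) = set js" .
    then show "distinct (?f \<sigma>)"
      using assms by (metis card_distinct distinct_card length_map length_upt diff_zero)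
  qed
  then have "?f ` {\<sigma>. \<sigma> permutes {..<?n}} \<subseteq> permutations_of_set (set js)" by auto
  moreover have "card (?f ` {\<sigma>. \<sigma> permutes {..<?n}}) = card (permutations_of_set (set js))"
    using assms by (simp add: card_image[OF inj] card_permutations distinct_card)
  ultimately show ?thesis
    using inj by (simp add: bij_betw_def card_subset_eq)
qed

section \<open>Permutations and positions\<close>

text \<open>Since js is increasing, comparing its entries is the same as comparing their
  positions.\<close>

lemma inversions_eq_list_inversions:
  assumes js: "sorted_wrt (<) js" and \<sigma>: "\<sigma> permutes {..<length js}"
  shows "inversions (length js) \<sigma> = list_inversions (map (\<lambda>t. js ! \<sigma> t) [0..<length js])"
proof -
  let ?xs = "map (\<lambda>t. js ! \<sigma> t) [0..<length js]"
  have lt: "\<sigma> t < length js" if "t < length js" for t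
    using permutes_in_image[OF \<sigma>, of t] that by simp
  have mono: "js ! i < js ! j \<longleftrightarrow> i < j" if "i < length js" "j < length js" for i j
    using that js sorted_wrt_nth_less[OF js, of i j] sorted_wrt_nth_less[OF js, of j i]
    by (metis less_irrefl less_trans nat_neq_iff)
  have "distinct js" using js by (simp add: strict_sorted_iff)
  then have "distinct ?xs"
    using permutations_of_setD(2) bij_betw_apply[OF bij_betw_permutes_permutations_of_set] \<sigma> by blast
  then have "list_inversions ?xs = card {(t, u). t < u \<and> u < length js \<and> ?xs ! t > ?xs ! u}"
    by (simp add: list_inversions_eq_card)
  also have "{(t, u). t < u \<and> u < length js \<and> ?xs ! t > ?xs ! u} =
      {(t, u). t < u \<and> u < length js \<and> \<sigma> t > \<sigma> u}"
    using lt mono by auto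
  finally show ?thesis by (simp add: inversions_def)
qed

text \<open>In increasing order the elements of J have ranks 0, 1, ...,
  \<open>card J - 1\<close>.\<close>

lemma sum_below_self: "finite J \<Longrightarrow> (\<Sum>j\<in>J. below J j) = \<Sum>{..<card J}"
proof (induction J rule: finite_linorder_max_induct)
  case (insert x J)
  have x: "x \<notin> J" using insert by auto
  have "below (insert x J) j = below J j" if "j \<in> J" for j
    using insert x that by (auto simp: below_insert)
  moreover have "below (insert x J) x = card J"
    using insert x by (auto simp: below_insert intro!: below_eq_card)
  ultimately show ?case
    using insert x by (simp add: lessThan_Suc)
qed simp

text \<open>The exponent of the hyper-Pfaffian recursion counts the inversions between \<open>J\<close> and its complement.\<close>

lemma cross_inv_positions:
  assumes J: "J \<subseteq> {2..L}" "card J = m - 1" and m: "1 \<le> m"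
  shows "cross_inv J ({2..L} - J) = \<Sum>J - \<Sum>{2..m}"
proof -
  have fJ: "finite J" using J(1) by (rule finite_subset) simp
  \<comment> \<open>Position 1 belongs to s_1 and is kept out of both sets, so j has j - 2
    predecessors. This offset turns the ranks 0, ..., m - 2 within J into the subtracted sum over
    {2..m}.\<close>
  have "below {2..L} j = j - 2" if "j \<in> J" for j
  proof -
    have "{s \<in> {2..L}. s < j} = {2..<j}" using that J by auto
    then show ?thesis by (simp add: below_def)
  qed
  moreover have "below {2..L} j = below J j + below ({2..L} - J) j" for j
    using below_Un_disjoint[of J "{2..L} - J" j] J fJ by (simp add: Un_absorb1)
  ultimately have "j = below ({2..L} - J) j + below J j + 2" if "j \<in> J" for j
    using that J by (metis add.commute atLeastAtMost_iff le_add_diff_inverse subsetD)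
  then have "\<Sum>J = (\<Sum>j\<in>J. below ({2..L} - J) j + below J j + 2)"
    by (intro sum.cong refl)
  also have "\<dots> = cross_inv J ({2..L} - J) + (\<Sum>{..<m - 1} + 2 * (m - 1))"
    by (simp only: sum.distrib cross_inv_def sum_below_self[OF fJ] J sum_constant of_nat_id ac_simps)
  also have "\<Sum>{..<m - 1} + 2 * (m - 1) = (\<Sum>i<m - 1. i + 2)"
    by (simp only: sum.distrib sum_constant card_lessThan of_nat_id mult.commute)
  also have "\<dots> = \<Sum>{2..m}"
    by (rule sum.reindex_bij_witness[where i = "\<lambda>i. i - 2" and j = "\<lambda>i. i + 2"]) (use m in auto)
  finally show ?thesis by simp
qed

text \<open>Positions are counted from 1, as in the recursion of \<^const>\<open>hyper_pf_bracket\<close>.\<close>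

lemma bij_betw_positions:
  fixes x :: nat
  assumes s: "sorted_wrt (<) (x # s)"
  shows "bij_betw (\<lambda>j. (x # s) ! (j - 1)) {2..length (x # s)} (set s)"
proof -
  let ?f = "\<lambda>j. (x # s) ! (j - 1)"
  have "?f ` {2..length (x # s)} = set s"
  proof (intro Set.set_eqI iffI)
    fix y assume "y \<in> set s"
    then obtain i where "i < length s" "y = s ! i" by (auto simp: in_set_conv_nth)
    then show "y \<in> ?f ` {2..length (x # s)}"
      by (intro image_eqI[of _ _ "i + 2"]) auto
  next
    fix y assume "y \<in> ?f ` {2..length (x # s)}"
    then obtain j where "j \<in> {2..length (x # s)}" "y = ?f j" by blast
    then show "y \<in> set s" by (cases "j - 1") auto
  qed
  moreover have "inj_on ?f {2..length (x # s)}"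
  proof (rule inj_onI)
    fix i j assume *: "i \<in> {2..length (x # s)}" "j \<in> {2..length (x # s)}" "?f i = ?f j"
    then have "i - 1 < length (x # s)" "j - 1 < length (x # s)"
      unfolding atLeastAtMost_iff by linarith+
    moreover have "distinct (x # s)" using s by (simp only: strict_sorted_iff)
    ultimately have "i - 1 = j - 1"
      using *(3) nth_eq_iff_index_eq by blast
    then show "i = j" using *(1,2) unfolding atLeastAtMost_iff by linarith
  qed
  ultimately show ?thesis by (simp add: bij_betw_def)
qed

lemma sorted_list_of_set_nths:
  fixes s :: "nat list"
  assumes "sorted_wrt (<) s"
  shows "nths s A = sorted_list_of_set {s ! i | i. i < length s \<and> i \<in> A}"
proof -
  have "sorted_wrt (<) (nths s A)"
    using assms by (simp add: strict_sorted_iff sorted_nths distinct_nthsI)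
  then show ?thesis
    by (metis sorted_list_of_set.idem_if_sorted_distinct strict_sorted_iff set_nths)
qed

text \<open>Translates a summand of the recursion from positions to row indices. The map from
  positions to entries is increasing, so the sublists are sorted lists of images and the inversion
  count is preserved.\<close>

lemma positions_nths:
  assumes s: "sorted_wrt (<) (x # s)" and J: "J \<subseteq> {2..length (x # s)}"
  defines "I \<equiv> (\<lambda>j. (x # s) ! (j - 1)) ` J"
  shows "nths (x # s) {i. Suc i \<in> insert 1 J} = sorted_list_of_set (insert x I)"
    and "nths (x # s) {i. Suc i \<notin> insert 1 J} = sorted_list_of_set (set s - I)"
    and "cross_inv I (set s - I) = cross_inv J ({2..length (x # s)} - J)"
proof -
  let ?f = "\<lambda>j. (x # s) ! (j - 1)"
  let ?A = "{2..length (x # s)}"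
  have bij: "bij_betw ?f ?A (set s)" by (rule bij_betw_positions[OF s])
  have inj: "inj_on ?f ?A" and im: "?f ` ?A = set s" using bij by (simp_all add: bij_betw_def)
  have compl: "set s - I = ?f ` (?A - J)"
    using inj_on_image_set_diff[OF inj, of ?A J] J im by (simp add: I_def)
  have "{(x # s) ! i | i. i < length (x # s) \<and> Suc i \<in> insert 1 J} = insert x I"
  proof (intro Set.set_eqI iffI)
    fix y assume "y \<in> insert x I"
    then consider "y = x" | j where "j \<in> J" "y = ?f j" by (auto simp: I_def)
    then show "y \<in> {(x # s) ! i | i. i < length (x # s) \<and> Suc i \<in> insert 1 J}"
    proof cases
      case 1
      then show ?thesis by (intro CollectI exI[of _ 0]) auto
    next
      case 2
      then have "2 \<le> j" "j \<le> length (x # s)" using J by (auto simp del: list.size)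
      then have "j - 1 < length (x # s)" "Suc (j - 1) = j" by linarith+
      then show ?thesis using 2 by (intro CollectI exI[of _ "j - 1"]) auto
    qed
  next
    fix y assume "y \<in> {(x # s) ! i | i. i < length (x # s) \<and> Suc i \<in> insert 1 J}"
    then obtain i where "y = (x # s) ! i" "i = 0 \<or> Suc i \<in> J" by auto
    then show "y \<in> insert x I" unfolding I_def by (auto intro!: image_eqI[of _ _ "Suc i"])
  qed
  then show "nths (x # s) {i. Suc i \<in> insert 1 J} = sorted_list_of_set (insert x I)"
    by (simp only: sorted_list_of_set_nths[OF s] mem_Collect_eq)
  have "{(x # s) ! i | i. i < length (x # s) \<and> Suc i \<notin> insert 1 J} = set s - I"
    unfolding compl
  proof (intro Set.set_eqI iffI)
    fix y assume "y \<in> {(x # s) ! i | i. i < length (x # s) \<and> Suc i \<notin> insert 1 J}"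
    then obtain i where "y = (x # s) ! i" "Suc i \<in> ?A - J" by auto
    then show "y \<in> ?f ` (?A - J)" by (intro image_eqI[of _ _ "Suc i"]) auto
  next
    fix y assume "y \<in> ?f ` (?A - J)"
    then obtain j where "y = ?f j" "j \<in> ?A - J" by blast
    then show "y \<in> {(x # s) ! i | i. i < length (x # s) \<and> Suc i \<notin> insert 1 J}"
      by (intro CollectI exI[of _ "j - 1"]) auto
  qed
  then show "nths (x # s) {i. Suc i \<notin> insert 1 J} = sorted_list_of_set (set s - I)"
    by (simp only: sorted_list_of_set_nths[OF s] mem_Collect_eq)
  have lt: "?f i < ?f j" if "i < j" "i \<in> ?A" "j \<in> ?A" for i j
  proof (rule sorted_wrt_nth_less[OF s])
    show "i - 1 < j - 1" "j - 1 < length (x # s)"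
      using that unfolding atLeastAtMost_iff by linarith+
  qed
  have mono: "?f i < ?f j \<longleftrightarrow> i < j" if "i \<in> ?A" "j \<in> ?A" for i j
    using that lt[of i j] lt[of j i] by (cases i j rule: linorder_cases) (blast dest: less_asym)+
  have "below (set s - I) (?f j) = below (?A - J) j" if "j \<in> J" for j
  proof -
    have m: "?f i < ?f j \<longleftrightarrow> i < j" if "i \<in> ?A - J" for i
      using that \<open>j \<in> J\<close> J by (intro mono) auto
    have "{y \<in> set s - I. y < ?f j} = {y \<in> ?f ` (?A - J). y < ?f j}"
      unfolding compl ..
    also have "\<dots> = ?f ` {i \<in> ?A - J. ?f i < ?f j}"
      by blast
    also have "{i \<in> ?A - J. ?f i < ?f j} = {i \<in> ?A - J. i < j}"
      using m by blast
    finally have "card {y \<in> set s - I. y < ?f j} = card (?f ` {i \<in> ?A - J. i < j})"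
      by (rule arg_cong)
    also have "\<dots> = card {i \<in> ?A - J. i < j}"
      by (intro card_image inj_on_subset[OF inj]) auto
    finally show ?thesis unfolding below_def .
  qed
  then show "cross_inv I (set s - I) = cross_inv J (?A - J)"
    unfolding cross_inv_def I_def using inj_on_subset[OF inj J] by (simp add: sum.reindex)
qed

section \<open>Passage to the quotient algebra\<close>

definition qmat_proj :: "complex \<Rightarrow> nat \<Rightarrow> ncpoly \<Rightarrow> ncpoly set" where
  "qmat_proj q N x = qmat_ideal q N +>\<^bsub>free_algebra N\<^esub> x"

text \<open>The type also contains polynomials in letters outside the array. With the carrier
  conditions included, \<open>qmat_cong q N x x\<close> expresses membership in the algebra, so
  reflexivity lemmas double as closure lemmas.\<close>

definition qmat_cong :: "complex \<Rightarrow> nat \<Rightarrow> ncpoly \<Rightarrow> ncpoly \<Rightarrow> bool" where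
  "qmat_cong q N x y \<longleftrightarrow>
     x \<in> carrier (free_algebra N) \<and> y \<in> carrier (free_algebra N) \<and> x - y \<in> qmat_ideal q N"

lemma free_algebra_sel:
  "mult (free_algebra N) = (*)" "one (free_algebra N) = 1" "zero (free_algebra N) = 0"
  "add (free_algebra N) = (+)"
  by (simp_all add: free_algebra_def)

lemma qmat_sel:
  "carrier (quantum_matrix_algebra q N) = carrier (free_algebra N Quot qmat_ideal q N)"
  "mult (quantum_matrix_algebra q N) = mult (free_algebra N Quot qmat_ideal q N)"
  "one (quantum_matrix_algebra q N) = one (free_algebra N Quot qmat_ideal q N)"
  "zero (quantum_matrix_algebra q N) = zero (free_algebra N Quot qmat_ideal q N)"
  "add (quantum_matrix_algebra q N) = add (free_algebra N Quot qmat_ideal q N)"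
  by (simp_all add: quantum_matrix_algebra_def ring.defs module.defs)

lemma var_closed: "i \<in> {1..N} \<Longrightarrow> j \<in> {1..N} \<Longrightarrow> var i j \<in> carrier (free_algebra N)"
  by (simp add: var_def free_algebra_def)

lemma scal_closed: "scal c \<in> carrier (free_algebra N)"
  by (simp add: scal_def free_algebra_def zero_word_def)

lemma free_algebra_mult_closed:
  "x \<in> carrier (free_algebra N) \<Longrightarrow> y \<in> carrier (free_algebra N) \<Longrightarrow> x * y \<in> carrier (free_algebra N)"
  using ring.ring_simprules(5)[OF ring_free_algebra, of x N y] by (simp add: free_algebra_sel)

lemma free_algebra_add_closed:
  "x \<in> carrier (free_algebra N) \<Longrightarrow> y \<in> carrier (free_algebra N) \<Longrightarrow> x + y \<in> carrier (free_algebra N)"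
  using ring.ring_simprules(1)[OF ring_free_algebra, of x N y] by (simp add: free_algebra_sel)

lemma free_algebra_1_closed: "1 \<in> carrier (free_algebra N)"
  and free_algebra_0_closed: "0 \<in> carrier (free_algebra N)"
  using ring.ring_simprules(2,6)[OF ring_free_algebra, of N] by (simp_all add: free_algebra_sel)

lemma free_algebra_sum_closed:
  "(\<And>i. i \<in> A \<Longrightarrow> f i \<in> carrier (free_algebra N)) \<Longrightarrow> sum f A \<in> carrier (free_algebra N)"
  by (induction A rule: infinite_finite_induct)
    (auto intro: free_algebra_0_closed free_algebra_add_closed)

lemma scal_mult: "scal (c * d) = scal c * scal d"
  and scal_1: "scal 1 = 1" and scal_0: "scal 0 = 0" and scal_minus: "scal (- c) = - scal c"
  and scal_diff: "scal (c - d) = scal c - scal d"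
  by (simp_all add: scal_def mult_single single_uminus single_diff)

lemma scal_power: "scal (c ^ n) = scal c ^ n"
  by (induction n) (simp_all add: scal_1 scal_mult)

lemma scal_central: "scal c * x = x * scal c"
proof (induction x rule: update_induct)
  case (update f w d)
  have "Poly_Mapping.update w d f = f + Poly_Mapping.single w d"
    using update by (intro poly_mapping_eqI) (auto simp: lookup_update lookup_add lookup_single when_def in_keys_iff)
  moreover have "scal c * Poly_Mapping.single w d = Poly_Mapping.single w d * scal c"
    by (simp add: scal_def mult_single mult.commute)
  ultimately show ?case using update by (simp add: distrib_left distrib_right)
qed simp

lemma smult_free_algebra: "c \<odot>\<^bsub>free_algebra N\<^esub> x = scal c * x"
  by (simp add: free_algebra_def scal_def mult_map_scale_conv_mult)

lemma qmat_ideal_add: "x \<in> qmat_ideal q N \<Longrightarrow> y \<in> qmat_ideal q N \<Longrightarrow> x + y \<in> qmat_ideal q N"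
  using additive_subgroup.a_closed[OF ideal.axioms(1)[OF ideal_qmat_ideal], of x q N y]
  by (simp add: free_algebra_sel)

lemma qmat_ideal_mult_left:
  "x \<in> qmat_ideal q N \<Longrightarrow> c \<in> carrier (free_algebra N) \<Longrightarrow> c * x \<in> qmat_ideal q N"
  using ideal.I_l_closed[OF ideal_qmat_ideal, of x q N c] by (simp add: free_algebra_sel)

lemma qmat_ideal_mult_right:
  "x \<in> qmat_ideal q N \<Longrightarrow> c \<in> carrier (free_algebra N) \<Longrightarrow> x * c \<in> qmat_ideal q N"
  using ideal.I_r_closed[OF ideal_qmat_ideal, of x q N c] by (simp add: free_algebra_sel)

lemma qmat_ideal_uminus: "x \<in> qmat_ideal q N \<Longrightarrow> - x \<in> qmat_ideal q N"
  using qmat_ideal_mult_left[OF _ scal_closed, of x q N "- 1"] by (simp add: scal_minus scal_1)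

lemma qmat_ideal_0: "0 \<in> qmat_ideal q N"
  using additive_subgroup.zero_closed[OF ideal.axioms(1)[OF ideal_qmat_ideal], of N q]
  by (simp add: free_algebra_sel)

lemma qmat_relators_in_ideal: "x \<in> qmat_relators q N \<Longrightarrow> x \<in> qmat_ideal q N"
  by (auto simp: qmat_ideal_def genideal_def)

lemma qmat_proj_eq: "qmat_cong q N x y \<Longrightarrow> qmat_proj q N x = qmat_proj q N y"
proof -
  assume xy: "qmat_cong q N x y"
  interpret I: ideal "qmat_ideal q N" "free_algebra N" by (rule ideal_qmat_ideal)
  have "x \<in> qmat_ideal q N +>\<^bsub>free_algebra N\<^esub> y"
    using xy unfolding a_r_coset_def' qmat_cong_def
    by (auto simp: free_algebra_sel intro!: bexI[of _ "x - y"])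
  then show ?thesis
    using I.a_repr_independence'[of x y] xy by (simp add: qmat_cong_def qmat_proj_def)
qed

lemma qmat_proj_hom: "qmat_proj q N \<in> ring_hom (free_algebra N) (quantum_matrix_algebra q N)"
proof -
  have "(+>\<^bsub>free_algebra N\<^esub>) (qmat_ideal q N) \<in> ring_hom (free_algebra N) (free_algebra N Quot qmat_ideal q N)"
    by (rule ideal.rcos_ring_hom[OF ideal_qmat_ideal])
  then show ?thesis
    unfolding ring_hom_def qmat_sel qmat_proj_def[abs_def] by simp
qed

lemma qmat_proj_mult:
  "x \<in> carrier (free_algebra N) \<Longrightarrow> y \<in> carrier (free_algebra N) \<Longrightarrow>
    qmat_proj q N x \<otimes>\<^bsub>quantum_matrix_algebra q N\<^esub> qmat_proj q N y = qmat_proj q N (x * y)"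
  using ring_hom_mult[OF qmat_proj_hom, of x N y q] by (simp add: free_algebra_sel)

lemma qmat_proj_closed:
  "x \<in> carrier (free_algebra N) \<Longrightarrow> qmat_proj q N x \<in> carrier (quantum_matrix_algebra q N)"
  by (rule ring_hom_closed[OF qmat_proj_hom])

lemma qmat_proj_smult:
  "x \<in> carrier (free_algebra N) \<Longrightarrow>
    c \<odot>\<^bsub>quantum_matrix_algebra q N\<^esub> qmat_proj q N x = qmat_proj q N (scal c * x)"
  unfolding qmat_proj_def by (simp add: smult_quantum_matrix_algebra smult_free_algebra)

lemma qmat_proj_sum:
  "(\<And>i. i \<in> A \<Longrightarrow> f i \<in> carrier (free_algebra N)) \<Longrightarrow> finite A \<Longrightarrow>
    (\<Oplus>\<^bsub>quantum_matrix_algebra q N\<^esub>i\<in>A. qmat_proj q N (f i)) = qmat_proj q N (sum f A)"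
proof -
  assume f: "\<And>i. i \<in> A \<Longrightarrow> f i \<in> carrier (free_algebra N)" and "finite A"
  interpret M: ring "quantum_matrix_algebra q N" by (rule ring_quantum_matrix_algebra)
  from \<open>finite A\<close> f show ?thesis
  proof (induction A rule: finite_induct)
    case empty
    then show ?case
      using ring_hom_zero[OF qmat_proj_hom ring_free_algebra ring_quantum_matrix_algebra, of q N]
      by (simp add: free_algebra_sel)
  next
    case (insert i A)
    then show ?case
      using ring_hom_add[OF qmat_proj_hom, of "f i" N "sum f A" q] free_algebra_sum_closed[of A f N]
      by (subst M.finsum_insert) (auto simp: qmat_proj_closed free_algebra_sel)
  qed
qed

lemma qmat_proj_ordered_prod:
  "set xs \<subseteq> carrier (free_algebra N) \<Longrightarrow>
    prod_list xs \<in> carrier (free_algebra N) \<and>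
    ordered_prod (quantum_matrix_algebra q N) (map (qmat_proj q N) xs) = qmat_proj q N (prod_list xs)"
proof (induction xs)
  case Nil
  then show ?case
    using ring_hom_one[OF qmat_proj_hom, of q N]
    by (simp add: ordered_prod_def free_algebra_sel free_algebra_1_closed)
next
  case (Cons x xs)
  then show ?case
    by (auto simp: ordered_prod_def qmat_proj_mult free_algebra_mult_closed)
qed

lemma qmat_cong_mult:
  assumes "qmat_cong q N x x'" "qmat_cong q N y y'"
  shows "qmat_cong q N (x * y) (x' * y')"
proof -
  have "(x - x') * y + x' * (y - y') \<in> qmat_ideal q N"
    using assms by (intro qmat_ideal_add qmat_ideal_mult_left qmat_ideal_mult_right)
      (auto simp: qmat_cong_def)
  then show ?thesis
    using assms by (auto simp: qmat_cong_def free_algebra_mult_closed algebra_simps)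
qed

lemma qmat_cong_add:
  assumes "qmat_cong q N x x'" "qmat_cong q N y y'"
  shows "qmat_cong q N (x + y) (x' + y')"
  using assms qmat_ideal_add[of "x - x'" q N "y - y'"]
  by (auto simp: qmat_cong_def free_algebra_add_closed algebra_simps)

lemma qmat_cong_refl: "x \<in> carrier (free_algebra N) \<Longrightarrow> qmat_cong q N x x"
  by (simp add: qmat_cong_def qmat_ideal_0)

lemma quantum_matrix_congruence_qmat:
  assumes "q \<noteq> 0"
  shows "quantum_matrix_congruence (qmat_cong q N) (scal (- q)) var {1..N}"
proof
  show "finite {1..N}" by simp
next
  fix x y assume "qmat_cong q N x y"
  then show "qmat_cong q N y x"
    using qmat_ideal_uminus[of "x - y"] by (simp add: qmat_cong_def)
next
  fix x y z assume "qmat_cong q N x y" "qmat_cong q N y z"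
  then show "qmat_cong q N x z"
    using qmat_ideal_add[of "x - y" q N "y - z"] by (simp add: qmat_cong_def)
next
  fix i j k assume *: "i \<in> {1..N}" "j \<in> {1..N}" "k \<in> {1..N}" "i < j"
  have "var i k * var j k - scal q * var j k * var i k \<in> qmat_relators q N"
    unfolding qmat_relators_def using * by blast
  then show "qmat_cong q N (var i k * var j k + scal (- q) * (var j k * var i k)) 0"
    using * qmat_relators_in_ideal
    by (simp add: qmat_cong_def free_algebra_0_closed free_algebra_add_closed free_algebra_mult_closed
      var_closed scal_closed) (simp add: scal_minus mult.assoc)
next
  fix i j k l assume *: "i \<in> {1..N}" "j \<in> {1..N}" "k \<in> {1..N}" "l \<in> {1..N}" "i < j" "k < l"
  let ?r = "var j k * var i l - var i l * var j k"
  let ?s = "var i k * var j l - var j l * var i k - scal (q - inverse q) * var i l * var j k"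
  have "?r \<in> qmat_relators q N" "?s \<in> qmat_relators q N"
    unfolding qmat_relators_def using * by blast+
  then have rs: "?r \<in> qmat_ideal q N" "?s \<in> qmat_ideal q N"
    by (auto intro: qmat_relators_in_ideal)
  then show "qmat_cong q N (var j k * var i l) (var i l * var j k)"
    using * by (simp add: qmat_cong_def free_algebra_mult_closed var_closed)
  have inv: "scal q * (scal (inverse q) * x) = x" for x
    using assms by (simp flip: mult.assoc scal_mult add: scal_1)
  \<comment> \<open>Multiplying the cross relation by q clears the inverse of q; subtracting q^2
    times the commutation relation puts the q^2 term into the order required by
    \<open>rel_cross\<close>.\<close>
  have "scal q * ?s - scal q * (scal q * ?r) \<in> qmat_ideal q N"
    using qmat_ideal_add[OF qmat_ideal_mult_left[OF rs(2) scal_closed]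
      qmat_ideal_uminus[OF qmat_ideal_mult_left[OF qmat_ideal_mult_left[OF rs(1) scal_closed] scal_closed]]]
    by simp
  also have "scal q * ?s - scal q * (scal q * ?r) =
      (var i l * var j k + scal (- q) * (var j l * var i k)) -
      scal (- q) * (var i k * var j l + scal (- q) * (var j k * var i l))"
    by (simp add: scal_minus scal_diff mult.assoc left_diff_distrib right_diff_distrib distrib_left inv)
  finally show "qmat_cong q N (var i l * var j k + scal (- q) * (var j l * var i k))
      (scal (- q) * (var i k * var j l + scal (- q) * (var j k * var i l)))"
    using * by (simp add: qmat_cong_def free_algebra_mult_closed free_algebra_add_closed var_closed scal_closed)
next
  fix i j assume "i \<in> {1..N}" "j \<in> {1..N}"
  then show "qmat_cong q N (var i j) (var i j)"
    by (intro qmat_cong_refl var_closed)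
qed (auto intro: qmat_cong_add qmat_cong_mult qmat_cong_refl free_algebra_0_closed
  free_algebra_1_closed scal_closed scal_central)

section \<open>The hyper-Pfaffian\<close>

lemma row_minor_closed:
  assumes "q \<noteq> 0" "S \<subseteq> {1..N}" "K \<subseteq> {1..N}"
  shows "row_minor (scal (- q)) var S K \<in> carrier (free_algebra N)"
  using quantum_matrix_congruence.rdet_refl[OF quantum_matrix_congruence_qmat, of q S N K] assms
  by (simp add: qmat_cong_def)

text \<open>Both sides keep the factors in the order of the rows, so the representatives agree
  already in the free algebra and the projection can be applied term by term.\<close>

lemma quantum_minor_eq_row_minor:
  assumes "sorted_wrt (<) is" "sorted_wrt (<) js" and len: "length is = length js"
    and sub: "set is \<subseteq> {1..N}" "set js \<subseteq> {1..N}"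
  shows "quantum_minor (quantum_matrix_algebra q N) q (qmat_gen q N) is js =
    qmat_proj q N (row_minor (scal (- q)) var (set is) (set js))"
proof -
  interpret M: ring "quantum_matrix_algebra q N" by (rule ring_quantum_matrix_algebra)
  let ?M = "quantum_matrix_algebra q N" and ?C = "carrier (free_algebra N)"
  let ?xs = "\<lambda>\<sigma>. map (\<lambda>t. js ! \<sigma> t) [0..<length js]"
  let ?P = "{\<sigma>. \<sigma> permutes {..<length js}}"
  let ?g = "\<lambda>xs. scal (- q) ^ list_inversions xs * prod_list (map2 var is xs)"
  have dist: "distinct is" "distinct js"
    using assms by (simp_all add: strict_sorted_iff)
  have perm: "?xs \<sigma> \<in> permutations_of_set (set js)" if "\<sigma> \<in> ?P" for \<sigma>
    using bij_betw_apply[OF bij_betw_permutes_permutations_of_set[OF dist(2)] that] .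
  have vars: "set (map2 var is (?xs \<sigma>)) \<subseteq> ?C" if "\<sigma> \<in> ?P" for \<sigma>
  proof
    fix v assume "v \<in> set (map2 var is (?xs \<sigma>))"
    then obtain i j where "(i, j) \<in> set (zip is (?xs \<sigma>))" "v = var i j" by auto
    moreover have "set (?xs \<sigma>) = set js" using perm[OF that] by (rule permutations_of_setD)
    ultimately show "v \<in> ?C"
      using sub set_zip_leftD set_zip_rightD by (metis var_closed subsetD)
  qed
  have closed: "?g (?xs \<sigma>) \<in> ?C" if "\<sigma> \<in> ?P" for \<sigma>
    using vars[OF that] qmat_proj_ordered_prod
    by (metis scal_power scal_closed free_algebra_mult_closed)
  have "(- q) ^ inversions (length is) \<sigma> \<odot>\<^bsub>?M\<^esub>
      ordered_prod ?M (map (\<lambda>t. qmat_gen q N (is ! t) (js ! \<sigma> t)) [0..<length is]) =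
      qmat_proj q N (?g (?xs \<sigma>))" if \<sigma>: "\<sigma> \<in> ?P" for \<sigma>
  proof -
    have "map (\<lambda>t. qmat_gen q N (is ! t) (js ! \<sigma> t)) [0..<length is] =
        map (qmat_proj q N) (map2 var is (?xs \<sigma>))"
      by (rule nth_equalityI) (simp_all add: len qmat_gen_def qmat_proj_def)
    then show ?thesis
      using \<sigma> qmat_proj_ordered_prod[OF vars[OF \<sigma>]] assms(2)
      by (simp add: len inversions_eq_list_inversions qmat_proj_smult scal_power)
  qed
  then have "quantum_minor ?M q (qmat_gen q N) is js = (\<Oplus>\<^bsub>?M\<^esub>\<sigma>\<in>?P. qmat_proj q N (?g (?xs \<sigma>)))"
    unfolding quantum_minor_def len
    by (intro M.finsum_cong') (auto intro: qmat_proj_closed closed)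
  also have "\<dots> = qmat_proj q N (\<Sum>\<sigma>\<in>?P. ?g (?xs \<sigma>))"
    by (rule qmat_proj_sum) (auto intro: closed finite_permutations)
  also have "(\<Sum>\<sigma>\<in>?P. ?g (?xs \<sigma>)) = sum ?g (permutations_of_set (set js))"
    by (rule sum.reindex_bij_betw[OF bij_betw_permutes_permutations_of_set[OF dist(2)]])
  also have "\<dots> = wcoeff (scal (- q)) (\<lambda>i j. var j i) (set js) is"
    using dist len
    by (intro wcoeff_transpose_eq_sum_permutations[symmetric])
      (auto simp: scal_central distinct_card)
  also have "\<dots> = row_minor (scal (- q)) var (set is) (set js)"
    using assms(1) dist(1)
    by (simp add: row_minor_def strict_sorted_iff sorted_list_of_set.idem_if_sorted_distinct)
  finally show ?thesis .
qed

lemma bij_betw_image_card: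
  assumes "bij_betw f A B" "finite A"
  shows "bij_betw (image f) {J. J \<subseteq> A \<and> card J = r} {I. I \<subseteq> B \<and> card I = r}"
proof -
  have inj: "inj_on f J" if "J \<subseteq> A" for J
    using assms(1) that by (auto simp: bij_betw_def intro: inj_on_subset)
  have "I \<in> image f ` {J. J \<subseteq> A \<and> card J = r}" if I: "I \<subseteq> B" "card I = r" for I
  proof -
    have "f ` {j \<in> A. f j \<in> I} = I" using I assms(1) by (auto simp: bij_betw_def)
    moreover from this have "card {j \<in> A. f j \<in> I} = r"
      using card_image[OF inj[of "{j \<in> A. f j \<in> I}"]] I by auto
    ultimately show ?thesis by (intro image_eqI[of _ _ "{j \<in> A. f j \<in> I}"]) auto
  qed
  moreover have "f ` J \<in> {I. I \<subseteq> B \<and> card I = r}" if "J \<in> {J. J \<subseteq> A \<and> card J = r}" for J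
    using that assms(1) card_image[OF inj] by (auto simp: bij_betw_def)
  ultimately have "image f ` {J. J \<subseteq> A \<and> card J = r} = {I. I \<subseteq> B \<and> card I = r}"
    by blast
  moreover have "inj_on (image f) {J. J \<subseteq> A \<and> card J = r}"
    using assms(1) by (intro inj_on_subset[OF inj_on_image_Pow[of f A]]) (auto simp: bij_betw_def)
  ultimately show ?thesis by (simp add: bij_betw_def)
qed

lemma blocks_eq: "blocks m {1..n} = {1..m * n}"
proof (induction n)
  case (Suc n)
  have "blocks m {1..Suc n} = block m (Suc n) \<union> blocks m {1..n}"
    using blocks_insert[of m "Suc n" "{1..n}"] by (simp add: atLeastAtMostSuc_conv)
  then show ?case using Suc by (auto simp: block_def)
qed (simp add: blocks_def)

text \<open>The rows have to be arbitrary, because the recursion passes to the complement of an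
  arbitrary choice; the columns always come in whole blocks. Counting from \<open>Suc p\<close>
  starts the induction at a single block, where the bracket is b.\<close>

lemma hyper_pf_bracket_eq:
  fixes q :: complex and m n :: nat
  defines "M \<equiv> quantum_matrix_algebra q (m * n)"
    and "b \<equiv> (\<lambda>is. \<Oplus>\<^bsub>quantum_matrix_algebra q (m * n)\<^esub>i \<in> {1..n}.
      quantum_minor (quantum_matrix_algebra q (m * n)) q (qmat_gen q (m * n)) is [m * (i - 1) + 1..<m * i + 1])"
  assumes q: "q \<noteq> 0" and m: "2 \<le> m" and root: "(- q) ^ (m * (m - 2)) = 1"
  shows "sorted_wrt (<) s \<Longrightarrow> set s \<subseteq> {1..m * n} \<Longrightarrow> length s = m * Suc p \<Longrightarrow>
    hyper_pf_bracket M q m b (Suc p) s =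
      qmat_proj q (m * n) (\<Sum>D\<in>{D. D \<subseteq> {1..n} \<and> card D = Suc p}.
        row_minor (scal (- q)) var (set s) (blocks m D))"
proof -
  let ?N = "m * n" and ?Q = "scal (- q)"
  let ?X = "{1..?N}" and ?C = "carrier (free_algebra ?N)" and ?\<pi> = "qmat_proj q ?N"
  let ?R = "row_minor ?Q var"
  interpret M: ring M unfolding M_def by (rule ring_quantum_matrix_algebra)
  interpret quantum_matrix_congruence "qmat_cong q ?N" ?Q var ?X
    using q by (rule quantum_matrix_congruence_qmat)
  have blocks_sub: "blocks m D \<subseteq> ?X" if "D \<subseteq> {1..n}" for D
    using that blocks_eq[of m n] unfolding blocks_def by blast
  have block_sub: "block m c \<subseteq> ?X" if "c \<in> {1..n}" for c
    using blocks_sub[of "{c}"] that by (simp add: blocks_def)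
  have R_closed: "?R S (block m c) \<in> ?C" if "S \<subseteq> ?X" "c \<in> {1..n}" for S c
    using q that(1) block_sub[OF that(2)] by (rule row_minor_closed)
  have sum_block_closed: "(\<Sum>c\<in>{1..n}. ?R S (block m c)) \<in> ?C" if "S \<subseteq> ?X" for S
    using that by (intro free_algebra_sum_closed R_closed)
  have sum_blocks_closed: "(\<Sum>D\<in>{D. D \<subseteq> {1..n} \<and> card D = r}. ?R S (blocks m D)) \<in> ?C"
    if "S \<subseteq> ?X" for S r
    using that blocks_sub q by (intro free_algebra_sum_closed row_minor_closed) auto
  have b: "b s = ?\<pi> (\<Sum>c\<in>{1..n}. ?R (set s) (block m c))"
    if s: "sorted_wrt (<) s" "set s \<subseteq> ?X" "length s = m" for s
  proof -
    have minor: "quantum_minor M q (qmat_gen q ?N) s [m * (c - 1) + 1..<m * c + 1] =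
        ?\<pi> (?R (set s) (block m c))" if c: "c \<in> {1..n}" for c
    proof -
      define u where "u = [m * (c - 1) + 1..<m * c + 1]"
      have "length u = m"
        using c card_block[of c m]
        by (simp only: u_def block_def length_upt card_atLeastLessThan atLeastAtMost_iff)
      moreover have "set u = block m c"
        by (simp only: u_def block_def set_upt)
      moreover have "sorted_wrt (<) u"
        unfolding u_def by (rule sorted_wrt_upt)
      ultimately show ?thesis
        unfolding M_def u_def[symmetric]
        using s block_sub[OF c] quantum_minor_eq_row_minor[of s u ?N q] by simp
    qed
    have "b s = (\<Oplus>\<^bsub>M\<^esub>c\<in>{1..n}. ?\<pi> (?R (set s) (block m c)))"
      unfolding b_def M_def[symmetric]
      by (intro M.finsum_cong' refl minor Pi_I qmat_proj_closed[of _ ?N q, folded M_def] R_closed s(2))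
    also have "\<dots> = ?\<pi> (\<Sum>c\<in>{1..n}. ?R (set s) (block m c))"
      unfolding M_def by (intro qmat_proj_sum R_closed s(2) finite_atLeastAtMost)
    finally show ?thesis .
  qed
  show "sorted_wrt (<) s \<Longrightarrow> set s \<subseteq> ?X \<Longrightarrow> length s = m * Suc p \<Longrightarrow>
    hyper_pf_bracket M q m b (Suc p) s =
      ?\<pi> (\<Sum>D\<in>{D. D \<subseteq> {1..n} \<and> card D = Suc p}. ?R (set s) (blocks m D))"
  proof (induction p arbitrary: s)
    case 0
    have "{D. D \<subseteq> {1..n} \<and> card D = Suc 0} = (\<lambda>c. {c}) ` {1..n}"
      by (auto simp: card_Suc_eq)
    then have "(\<Sum>D\<in>{D. D \<subseteq> {1..n} \<and> card D = Suc 0}. ?R (set s) (blocks m D)) =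
        (\<Sum>c\<in>{1..n}. ?R (set s) (block m c))"
      by (simp add: sum.reindex blocks_def)
    then show ?case using 0 b by simp
  next
    case (Suc p)
    let ?L = "length s"
    have "s \<noteq> []" using Suc.prems(3) m by auto
    then obtain x t where s: "s = x # t" by (cases s) auto
    let ?f = "\<lambda>j. s ! (j - 1)" and ?S = "set t"
    let ?JJ = "{J. J \<subseteq> {2..?L} \<and> card J = m - 1}" and ?II = "{I. I \<subseteq> ?S \<and> card I = m - 1}"
    let ?g = "\<lambda>I. ?Q ^ cross_inv I (?S - I) * ((\<Sum>c\<in>{1..n}. ?R (insert x I) (block m c)) *
       (\<Sum>C\<in>{C. C \<subseteq> {1..n} \<and> card C = Suc p}. ?R (?S - I) (blocks m C)))"
    have x: "x \<in> ?X" "?S \<subseteq> ?X" "\<And>i. i \<in> ?S \<Longrightarrow> x < i" using Suc.prems s by auto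
    have card_S: "Suc (card ?S) = m * Suc (Suc p)"
      using Suc.prems s by (simp add: strict_sorted_iff distinct_card)
    have bij: "bij_betw ?f {2..?L} ?S"
      using bij_betw_positions Suc.prems(1) unfolding s by blast
    have bij': "bij_betw (image ?f) ?JJ ?II"
      using bij by (rule bij_betw_image_card) simp
    have g_closed: "?g I \<in> ?C" if "I \<in> ?II" for I
      using that x unfolding scal_power[symmetric]
      by (intro free_algebra_mult_closed scal_closed sum_block_closed sum_blocks_closed) auto
    have summand: "(- q) ^ (\<Sum>J - \<Sum>{2..m}) \<odot>\<^bsub>M\<^esub> (b (nths s {i. Suc i \<in> insert 1 J}) \<otimes>\<^bsub>M\<^esub>
        hyper_pf_bracket M q m b (Suc p) (nths s {i. Suc i \<notin> insert 1 J})) = ?\<pi> (?g (?f ` J))"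
      if J: "J \<in> ?JJ" for J
    proof -
      define I where "I = ?f ` J"
      have I: "I \<subseteq> ?S" "card I = m - 1"
        using bij_betw_apply[OF bij' J] by (simp_all add: I_def)
      have fI: "finite I" using I(1) by (rule finite_subset) simp
      have xI: "x \<notin> I" using I x(3) by blast
      have JL: "J \<subseteq> {2..length (x # t)}" using J s by simp
      note nths = positions_nths[OF Suc.prems(1)[unfolded s] JL, folded s, folded I_def]
      have len: "card (insert x I) = m" using fI xI I(2) m by simp
      have cardD: "card (?S - I) = m * Suc p"
        using card_S I fI card_Diff_subset[OF fI I(1)] m by simp
      have "b (nths s {i. Suc i \<in> insert 1 J}) = ?\<pi> (\<Sum>c\<in>{1..n}. ?R (insert x I) (block m c))"
        unfolding nths(1) using b[of "sorted_list_of_set (insert x I)"] fI I(1) x(1,2) len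
        by (simp del: sorted_list_of_set_insert_remove add: subset_trans)
      moreover have "hyper_pf_bracket M q m b (Suc p) (nths s {i. Suc i \<notin> insert 1 J}) =
          ?\<pi> (\<Sum>C\<in>{C. C \<subseteq> {1..n} \<and> card C = Suc p}. ?R (?S - I) (blocks m C))"
        unfolding nths(2) using Suc.IH[of "sorted_list_of_set (?S - I)"] x(2) cardD
        by (simp add: subset_trans[OF Diff_subset])
      moreover have "\<Sum>J - \<Sum>{2..m} = cross_inv I (?S - I)"
        unfolding nths(3) using J m by (intro cross_inv_positions[symmetric]) auto
      moreover have "insert x I \<subseteq> ?X" "?S - I \<subseteq> ?X" using I x by auto
      ultimately show ?thesis
        unfolding I_def[symmetric] M_def
        by (simp only: qmat_proj_mult qmat_proj_smult sum_block_closed sum_blocks_closed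
          free_algebra_mult_closed scal_power)
    qed
    have "hyper_pf_bracket M q m b (Suc (Suc p)) s = (\<Oplus>\<^bsub>M\<^esub>J\<in>?JJ. ?\<pi> (?g (?f ` J)))"
      unfolding hyper_pf_bracket.simps Suc.prems(3)[symmetric]
      by (intro M.finsum_cong' refl summand Pi_I qmat_proj_closed[of _ ?N q, folded M_def] g_closed
        bij_betw_apply[OF bij'])
    also have "\<dots> = ?\<pi> (\<Sum>J\<in>?JJ. ?g (?f ` J))"
      unfolding M_def using bij_betw_apply[OF bij'] by (intro qmat_proj_sum g_closed) simp_all
    also have "(\<Sum>J\<in>?JJ. ?g (?f ` J)) = sum ?g ?II"
      by (rule sum.reindex_bij_betw[OF bij'])
    \<comment> \<open>From here on the representatives are only congruent; the projection turns the
      congruence of \<open>rdet_blocks_step\<close> into an equality.\<close>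
    also have "?\<pi> (sum ?g ?II) =
        ?\<pi> (\<Sum>D\<in>{D. D \<subseteq> {1..n} \<and> card D = Suc (Suc p)}. ?R (insert x ?S) (blocks m D))"
      using x m root blocks_sub[of "{1..n}"]
      by (intro qmat_proj_eq rdet_blocks_step) (auto simp: scal_1 simp flip: scal_power)
    finally show ?case by (simp add: s)
  qed
qed

theorem theorem3p7:
  fixes k m n :: nat and q :: complex
  assumes "k \<ge> 1" and "m = 2 * k" and "n \<ge> 1"
    and "q \<noteq> 0" and "q ^ (8 * (k choose 2)) = 1"
  shows "let M = quantum_matrix_algebra q (m * n);
             a = qmat_gen q (m * n);
             b = (\<lambda>is. \<Oplus>\<^bsub>M\<^esub>i \<in> {1..n}. quantum_minor M q a is [m * (i - 1) + 1..<m * i + 1])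
         in quantum_hyper_pfaffian M q m n b = quantum_det M q a (m * n)"
proof -
  let ?s = "[1..<m * n + 1]"
  have m: "2 \<le> m" and n: "n = Suc (n - 1)" using assms by simp_all
  have "m * (m - 2) = 4 * (k * (k - 1))"
    using assms(2) by (cases k) (simp_all add: algebra_simps)
  also have "k * (k - 1) = 2 * (k choose 2)"
    by (cases k) (simp_all add: choose_two)
  finally have "m * (m - 2) = 8 * (k choose 2)" by simp
  \<comment> \<open>The exponent is even, so the hypothesis on q carries over to -q.\<close>
  then have root: "(- q) ^ (m * (m - 2)) = 1"
    using assms(5) by (simp add: power_minus_even)
  have set_s: "set ?s = {1..m * n}"
    unfolding set_upt by (rule Set.set_eqI) (simp only: atLeastLessThan_iff atLeastAtMost_iff less_Suc_eq_le Suc_eq_plus1[symmetric])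
  have s: "sorted_wrt (<) ?s" "set ?s \<subseteq> {1..m * n}" "length ?s = m * Suc (n - 1)"
    using n set_s by (simp_all only: sorted_wrt_upt length_upt)
  \<comment> \<open>For brackets of full length only D = {1..n} remains, and its blocks comprise all
    columns.\<close>
  have "{D. D \<subseteq> {1..n} \<and> card D = n} = {{1..n}}"
    by (auto dest: card_subset_eq[rotated])
  moreover note set_s
  ultimately show ?thesis
    unfolding Let_def quantum_hyper_pfaffian_def quantum_det_def
    using hyper_pf_bracket_eq[OF assms(4) m root s] n
      quantum_minor_eq_row_minor[OF s(1) s(1) refl s(2) s(2)]
    by (simp add: blocks_eq[simplified])
qed

end
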